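(* For every $n\ge 1$, the uncrossing poset $P_n$ is dual CL-shellable, i.e. the dual poset $P_n^*$ admits a CL-labeling.
   Context: Uncrossing poset $P_n$: place $2n$ vertices (boundary nodes) around a circle, labeled clockwise $1,2,\dots,2n$. The elements of $P_n$ are a unique minimal element $\hat 0$ together with all complete matchings on these $2n$ nodes. Each matching is represented by a strand diagram with $n$ strands, each joining a matched pair of nodes; the minimal number of strand crossings needed to draw it in the disk is the number of pairs of strands $\{a,c\},\{b,d\}$ with $a<b<c<d$ (crossing pairs). $P_n$ is graded, the rank of a matching being one more than its minimal number of strand crossings (and $\hat 0$ having rank $0$). Uncrossing a crossing pair of strands $\{a,c\},\{b,d\}$ ($a<b<c<d$) means replacing it either by $\{a,b\},\{c,d\}$ or by $\{a,d\},\{b,c\}$. A matching $u$ is covered by a matching $v$ exactly when the rank of $u$ is one less than the rank of $v$ and $u$ is obtained from $v$ by uncrossing a single pair of strands. The elements covering $\hat 0$ are exactly the matchings with no crossings. The order on $P_n$ is generated by these cover relations. The dual $P^*$ of a poset $P$ has the same elements with the order reversed. CL-labeling: for a finite bounded poset $P$, let $E^*(P)=\{(c,x,y): c \text{ a maximal chain},\ x,y\in c,\ x\lessdot y\}$ and let $Q$ be a poset. A chain-edge labeling is a map $\lambda:E^*(P)\to Q$ such that whenever two maximal chains coincide along their first $d$ edges (from the bottom), they have the same labels on those edges. A rooted interval $[x,y]_r$ is an interval $[x,y]$ with a saturated chain $r$ from $\hat 0$ to $x$; each maximal chain $c$ of $[x,y]$ then has a well-defined label sequence $\lambda_r(c)$.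 $\lambda$ is a CL-labeling if for every rooted interval $[x,y]_r$ there is a unique ascending maximal chain $c$ (consecutive labels satisfy $\lambda_i<\lambda_{i+1}$), and $\lambda_r(c)$ lexicographically precedes the label sequences of all other maximal chains of $[x,y]_r$. *)

theory Defs
  imports Main "HOL-Library.Disjoint_Sets" "HOL-Library.Sublist"
begin

section \<open>Finite bounded posets and CL-labelings\<close>

text \<open>A poset is a carrier \<open>A\<close> with its reflexive order relation \<open>r\<close>; its dual is \<open>A\<close> with \<open>r\<inverse>\<close>.\<close>

definition is_bottom :: "'a set \<Rightarrow> 'a rel \<Rightarrow> 'a \<Rightarrow> bool" where
  "is_bottom A r b \<longleftrightarrow> b \<in> A \<and> (\<forall>x\<in>A. (b, x) \<in> r)"

definition is_top :: "'a set \<Rightarrow> 'a rel \<Rightarrow> 'a \<Rightarrow> bool" where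
  "is_top A r t \<longleftrightarrow> t \<in> A \<and> (\<forall>x\<in>A. (x, t) \<in> r)"

definition finite_bounded_poset :: "'a set \<Rightarrow> 'a rel \<Rightarrow> bool" where
  "finite_bounded_poset A r \<longleftrightarrow>
     finite A \<and> partial_order_on A r \<and> (\<exists>b. is_bottom A r b) \<and> (\<exists>t. is_top A r t)"

definition covers :: "'a rel \<Rightarrow> 'a \<Rightarrow> 'a \<Rightarrow> bool" where
  "covers r x y \<longleftrightarrow>
     (x, y) \<in> r \<and> x \<noteq> y \<and> (\<forall>z. (x, z) \<in> r \<and> (z, y) \<in> r \<longrightarrow> z = x \<or> z = y)"

text \<open>Chains are listed from bottom to top. In a finite poset the maximal chains of an interval
  \<open>[x, y]\<close> are the saturated chains from \<open>x\<close> to \<open>y\<close>; see \<open>saturated_chain_iff_maxchain\<close> below.\<close>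

definition saturated_chain :: "'a rel \<Rightarrow> 'a \<Rightarrow> 'a \<Rightarrow> 'a list \<Rightarrow> bool" where
  "saturated_chain r x y c \<longleftrightarrow>
     (x, y) \<in> r \<and> c \<noteq> [] \<and> hd c = x \<and> last c = y \<and> successively (covers r) c"

definition maximal_chains :: "'a set \<Rightarrow> 'a rel \<Rightarrow> 'a list set" where
  "maximal_chains A r =
     {c. \<exists>b t. is_bottom A r b \<and> is_top A r t \<and> saturated_chain r b t c}"

definition chain_edges :: "'a set \<Rightarrow> 'a rel \<Rightarrow> ('a list \<times> 'a \<times> 'a) set" where
  "chain_edges A r =
     {(c, x, y). c \<in> maximal_chains A r \<and> x \<in> set c \<and> y \<in> set c \<and> covers r x y}"

definition chain_edge_labeling ::
  "'a set \<Rightarrow> 'a rel \<Rightarrow> 'q set \<Rightarrow> ('a list \<times> 'a \<times> 'a \<Rightarrow> 'q) \<Rightarrow> bool" where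
  "chain_edge_labeling A r Q lam \<longleftrightarrow>
     lam ` chain_edges A r \<subseteq> Q \<and>
     (\<forall>c\<in>maximal_chains A r. \<forall>c'\<in>maximal_chains A r. \<forall>d.
        d < length c \<and> d < length c' \<and> take (Suc d) c = take (Suc d) c' \<longrightarrow>
        (\<forall>i<d. lam (c, c ! i, c ! Suc i) = lam (c', c' ! i, c' ! Suc i)))"

definition label_seq :: "('a list \<times> 'a \<times> 'a \<Rightarrow> 'q) \<Rightarrow> 'a list \<Rightarrow> 'a list \<Rightarrow> 'q list" where
  "label_seq lam m c = map (\<lambda>(x, y). lam (m, x, y)) (zip c (tl c))"

text \<open>The label sequence of a maximal chain \<open>c\<close> of the interval rooted at \<open>\<rho>\<close>, read off from any
  maximal chain \<open>m\<close> of the poset beginning with \<open>\<rho>\<close> followed by \<open>c\<close>. The choice of \<open>m\<close> is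
  immaterial; see \<open>rooted_label_seq_eq\<close> below.\<close>

definition rooted_label_seq ::
  "'a set \<Rightarrow> 'a rel \<Rightarrow> ('a list \<times> 'a \<times> 'a \<Rightarrow> 'q) \<Rightarrow> 'a list \<Rightarrow> 'a list \<Rightarrow> 'q list" where
  "rooted_label_seq A r lam \<rho> c =
     label_seq lam (SOME m. m \<in> maximal_chains A r \<and> prefix (\<rho> @ tl c) m) c"

definition CL_labeling ::
  "'a set \<Rightarrow> 'a rel \<Rightarrow> 'q set \<Rightarrow> 'q rel \<Rightarrow> ('a list \<times> 'a \<times> 'a \<Rightarrow> 'q) \<Rightarrow> bool" where
  "CL_labeling A r Q s lam \<longleftrightarrow>
     partial_order_on Q s \<and> chain_edge_labeling A r Q lam \<and>
     (\<forall>b x y \<rho>. is_bottom A r b \<and> (x, y) \<in> r \<and> saturated_chain r b x \<rho> \<longrightarrow>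
        (\<exists>c. saturated_chain r x y c \<and>
             successively (\<lambda>p q. (p, q) \<in> s - Id) (rooted_label_seq A r lam \<rho> c) \<and>
             (\<forall>c'. saturated_chain r x y c' \<and> c' \<noteq> c \<longrightarrow>
                \<not> successively (\<lambda>p q. (p, q) \<in> s - Id) (rooted_label_seq A r lam \<rho> c') \<and>
                (rooted_label_seq A r lam \<rho> c, rooted_label_seq A r lam \<rho> c') \<in> lexord (s - Id))))"

text \<open>Only the finitely many labels in use matter, so label posets on subsets of \<open>nat\<close>, with an
  arbitrary partial order \<open>s\<close> unrelated to the usual one, cover all label posets.\<close>

definition CL_shellable :: "'a set \<Rightarrow> 'a rel \<Rightarrow> bool" where
  "CL_shellable A r \<longleftrightarrow>
     finite_bounded_poset A r \<and> (\<exists>(Q :: nat set) s lam. CL_labeling A r Q s lam)"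

definition dual_CL_shellable :: "'a set \<Rightarrow> 'a rel \<Rightarrow> bool" where
  "dual_CL_shellable A r \<longleftrightarrow> CL_shellable A (r\<inverse>)"


section \<open>The uncrossing poset\<close>

definition matchings :: "nat \<Rightarrow> nat set set set" where
  "matchings n = {M. partition_on {1..2 * n} M \<and> (\<forall>e\<in>M. card e = 2)}"

text \<open>The ordering \<open>a < b < c < d\<close> makes every crossing pair of strands occur exactly once.\<close>

definition crossing_pairs :: "nat set set \<Rightarrow> (nat set \<times> nat set) set" where
  "crossing_pairs M =
     {(e, f). e \<in> M \<and> f \<in> M \<and>
        (\<exists>a b c d. a < b \<and> b < c \<and> c < d \<and> e = {a, c} \<and> f = {b, d})}"

definition uncrosses_to :: "nat set set \<Rightarrow> nat set set \<Rightarrow> bool" where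
  "uncrosses_to M N \<longleftrightarrow>
     (\<exists>a b c d. a < b \<and> b < c \<and> c < d \<and> {a, c} \<in> M \<and> {b, d} \<in> M \<and>
        (N = M - {{a, c}, {b, d}} \<union> {{a, b}, {c, d}} \<or>
         N = M - {{a, c}, {b, d}} \<union> {{a, d}, {b, c}}))"

text \<open>\<open>None\<close> is the adjoined minimal element.\<close>

definition uncrossing_poset :: "nat \<Rightarrow> nat set set option set" where
  "uncrossing_poset n = insert None (Some ` matchings n)"

fun uncrossing_rank :: "nat set set option \<Rightarrow> nat" where
  "uncrossing_rank None = 0"
| "uncrossing_rank (Some M) = card (crossing_pairs M) + 1"

definition uncrossing_covers :: "nat \<Rightarrow> nat set set option rel" where
  "uncrossing_covers n =
     {(None, Some M) | M. M \<in> matchings n \<and> crossing_pairs M = {}} \<union>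
     {(Some N, Some M) | N M. N \<in> matchings n \<and> M \<in> matchings n \<and> uncrosses_to M N \<and>
        uncrossing_rank (Some M) = uncrossing_rank (Some N) + 1}"

definition uncrossing_order :: "nat \<Rightarrow> nat set set option rel" where
  "uncrossing_order n = Restr ((uncrossing_covers n)\<^sup>*) (uncrossing_poset n)"


section \<open>Consistency of the definitions\<close>

lemma finite_matchings: "finite (matchings n)"
  by (rule finite_subset[of _ "Pow (Pow {1..2 * n})"])
     (auto simp: matchings_def partition_on_def)

lemma finite_uncrossing_poset: "finite (uncrossing_poset n)"
  by (simp add: uncrossing_poset_def finite_matchings)

lemma finite_crossing_pairs:
  assumes "M \<in> matchings n" shows "finite (crossing_pairs M)"
proof -
  have "M \<subseteq> Pow {1..2 * n}" using assms by (auto simp: matchings_def partition_on_def)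
  then have "finite M" by (rule finite_subset) simp
  moreover have "crossing_pairs M \<subseteq> M \<times> M" by (auto simp: crossing_pairs_def)
  ultimately show ?thesis by (meson finite_SigmaI finite_subset)
qed

lemma uncrossing_covers_rank:
  "(u, v) \<in> uncrossing_covers n \<Longrightarrow> uncrossing_rank v = uncrossing_rank u + 1"
  by (auto simp: uncrossing_covers_def)

lemma uncrossing_rtrancl_rank:
  "(u, v) \<in> (uncrossing_covers n)\<^sup>* \<Longrightarrow> u = v \<or> uncrossing_rank u < uncrossing_rank v"
  by (induction rule: rtrancl_induct) (use uncrossing_covers_rank in fastforce)+

lemma partial_order_uncrossing: "partial_order_on (uncrossing_poset n) (uncrossing_order n)"
proof -
  have "antisym (uncrossing_order n)"
  proof (rule antisymI)
    fix u v assume "(u, v) \<in> uncrossing_order n" "(v, u) \<in> uncrossing_order n"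
    then show "u = v"
      using uncrossing_rtrancl_rank[of u v n] uncrossing_rtrancl_rank[of v u n]
      by (auto simp: uncrossing_order_def)
  qed
  moreover have "trans (uncrossing_order n)"
    by (rule transI) (auto simp: uncrossing_order_def)
  ultimately show ?thesis
    by (auto simp: partial_order_on_def preorder_on_def refl_on_def uncrossing_order_def)
qed

lemma uncrossing_covers_subset: "uncrossing_covers n \<subseteq> uncrossing_order n"
  by (auto simp: uncrossing_order_def uncrossing_covers_def uncrossing_poset_def)

lemma covers_uncrossing_order:
  "covers (uncrossing_order n) u v \<longleftrightarrow> (u, v) \<in> uncrossing_covers n"
proof
  assume c: "covers (uncrossing_order n) u v"
  then have "(u, v) \<in> (uncrossing_covers n)\<^sup>*" "u \<noteq> v" "v \<in> uncrossing_poset n"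
    by (auto simp: covers_def uncrossing_order_def)
  then obtain w where w: "(u, w) \<in> uncrossing_covers n" "(w, v) \<in> (uncrossing_covers n)\<^sup>*"
    by (meson converse_rtranclE)
  then have "(u, w) \<in> uncrossing_order n" "(w, v) \<in> uncrossing_order n"
    using uncrossing_covers_subset[of n] \<open>v \<in> uncrossing_poset n\<close>
    by (auto simp: uncrossing_order_def)
  then have "w = u \<or> w = v" using c by (auto simp: covers_def)
  then show "(u, v) \<in> uncrossing_covers n" using w uncrossing_covers_rank[OF w(1)] by auto
next
  assume c: "(u, v) \<in> uncrossing_covers n"
  have "w = u \<or> w = v" if "(u, w) \<in> uncrossing_order n" "(w, v) \<in> uncrossing_order n" for w
    using that uncrossing_rtrancl_rank[of u w n] uncrossing_rtrancl_rank[of w v n]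
      uncrossing_covers_rank[OF c] by (auto simp: uncrossing_order_def)
  then show "covers (uncrossing_order n) u v"
    using c uncrossing_covers_subset[of n] uncrossing_covers_rank[OF c]
    by (auto simp: covers_def)
qed

lemma rooted_label_seq_eq:
  assumes lab: "chain_edge_labeling A r Q lam"
    and \<rho>: "\<rho> \<noteq> []" and c: "c \<noteq> []" "last \<rho> = hd c"
    and m: "m \<in> maximal_chains A r" "prefix (\<rho> @ tl c) m"
  shows "rooted_label_seq A r lam \<rho> c = label_seq lam m c"
proof -
  define m' where "m' = (SOME m. m \<in> maximal_chains A r \<and> prefix (\<rho> @ tl c) m)"
  have m': "m' \<in> maximal_chains A r" "prefix (\<rho> @ tl c) m'"
    unfolding m'_def using someI[of "\<lambda>m. m \<in> maximal_chains A r \<and> prefix (\<rho> @ tl c) m", OF conjI[OF m]]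
    by auto
  define d where "d = length (\<rho> @ tl c) - 1"
  have d: "Suc d = length (\<rho> @ tl c)" using \<rho> by (cases \<rho>) (auto simp: d_def)
  have tk: "take (Suc d) m = \<rho> @ tl c" "take (Suc d) m' = \<rho> @ tl c"
    using m(2) m'(2) unfolding d prefix_def by auto
  have ln: "d < length m" "d < length m'"
    using prefix_length_le[OF m(2)] prefix_length_le[OF m'(2)] d by linarith+
  have e: "lam (m, m ! i, m ! Suc i) = lam (m', m' ! i, m' ! Suc i)" if "i < d" for i
    using lab m(1) m'(1) ln tk that unfolding chain_edge_labeling_def by metis
  have split: "\<rho> @ tl c = butlast \<rho> @ c"
    using \<rho> c by (metis append.assoc append_Cons append_Nil append_butlast_last_id list.collapse)
  have nth: "M ! (length (butlast \<rho>) + j) = c ! j"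
    if "take (Suc d) M = \<rho> @ tl c" "j < length c" for M j
  proof -
    have "length (butlast \<rho>) + j < Suc d" using that d split by simp
    then have "M ! (length (butlast \<rho>) + j) = (butlast \<rho> @ c) ! (length (butlast \<rho>) + j)"
      using that(1) split by (metis nth_take)
    then show ?thesis by (simp only: nth_append_length_plus)
  qed
  have "lam (m', c ! j, c ! Suc j) = lam (m, c ! j, c ! Suc j)" if j: "Suc j < length c" for j
  proof -
    have "length (butlast \<rho>) + j < d" using j d split by simp
    from e[OF this] show ?thesis
      using nth[OF tk(1), of j] nth[OF tk(2), of j] nth[OF tk(1), of "Suc j"]
        nth[OF tk(2), of "Suc j"] j by simp
  qed
  then have "label_seq lam m' c = label_seq lam m c"
    by (auto simp: label_seq_def list_eq_iff_nth_eq nth_tl)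
  then show ?thesis by (simp add: rooted_label_seq_def m'_def)
qed

lemma saturated_chain_iff_maxchain:
  assumes fin: "finite A" and po: "partial_order_on A r" and xy: "(x, y) \<in> r"
  defines "lt \<equiv> \<lambda>u v. (u, v) \<in> r \<and> u \<noteq> v"
  shows "saturated_chain r x y c \<longleftrightarrow>
    sorted_wrt lt c \<and> pred_on.maxchain {z. (x, z) \<in> r \<and> (z, y) \<in> r} lt (set c)"
    (is "_ \<longleftrightarrow> _ \<and> pred_on.maxchain ?I lt (set c)")
proof -
  have rA: "r \<subseteq> A \<times> A" and tr: "trans r" and an: "antisym r" and rf: "\<And>z. z \<in> A \<Longrightarrow> (z, z) \<in> r"
    using po by (auto simp: partial_order_on_def preorder_on_def refl_on_def)
  have xI: "x \<in> ?I" and yI: "y \<in> ?I" using xy rA rf by auto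
  have tlt: "transp lt"
    unfolding lt_def using tr an by (auto intro!: transpI dest: transD antisymD)
  show ?thesis
  proof
    assume s: "saturated_chain r x y c"
    then have c: "c \<noteq> []" "hd c = x" "last c = y" and sc: "successively (covers r) c"
      by (auto simp: saturated_chain_def)
    have "successively lt c"
      using sc by (rule successively_mono) (auto simp: covers_def lt_def)
    then have so: "sorted_wrt lt c" using tlt by (simp only: successively_conv_sorted_wrt)
    have lo: "(x, u) \<in> r \<and> (u, y) \<in> r" if u: "u \<in> set c" for u
    proof
      show "(x, u) \<in> r"
        using so u c rA xy rf by (cases c) (auto simp: lt_def)
      show "(u, y) \<in> r"
        using so u c rA xy rf by (cases c rule: rev_cases) (auto simp: lt_def sorted_wrt_append)
    qed
    have ch: "pred_on.chain ?I lt (set c)"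
      unfolding pred_on.chain_def
    proof (intro conjI ballI)
      show "set c \<subseteq> ?I" using lo by auto
      fix u v assume "u \<in> set c" "v \<in> set c"
      then obtain i j where ij: "i < length c" "j < length c" "u = c ! i" "v = c ! j"
        by (metis in_set_conv_nth)
      then show "lt\<^sup>=\<^sup>= u v \<or> lt\<^sup>=\<^sup>= v u"
        using so by (cases i j rule: linorder_cases) (auto simp: sorted_wrt_iff_nth_less)
    qed
    moreover have "z \<in> set c" if S: "pred_on.chain ?I lt S" "set c \<subseteq> S" "z \<in> S" for S z
    proof (rule ccontr)
      assume z: "z \<notin> set c"
      have zI: "(x, z) \<in> r" "(z, y) \<in> r" using S by (auto simp: pred_on.chain_def)
      have cmp: "lt u z \<or> lt z u" if "u \<in> set c" for u
        using S that z by (auto simp: pred_on.chain_def)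
      have "lt (c ! i) z" if "i < length c" for i
        using that
      proof (induction i)
        case 0
        have "c ! 0 = x" using c by (simp add: hd_conv_nth)
        then show ?case using zI z 0 by (metis lt_def nth_mem)
      next
        case (Suc i)
        have cv: "covers r (c ! i) (c ! Suc i)" using sc Suc.prems by (simp add: successively_conv_nth)
        have ltz: "(c ! i, z) \<in> r" using Suc by (simp add: lt_def)
        show ?case
        proof (rule ccontr)
          assume "\<not> lt (c ! Suc i) z"
          then have "lt z (c ! Suc i)" using cmp Suc.prems nth_mem by blast
          then have "z = c ! i \<or> z = c ! Suc i" using cv ltz unfolding covers_def lt_def by blast
          then show False using z Suc.prems by (metis Suc_lessD nth_mem)
        qed
      qed
      then have "lt y z" using c by (metis diff_less last_conv_nth length_greater_0_conv zero_less_one)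
      then show False using zI an unfolding lt_def by (auto dest: antisymD)
    qed
    ultimately have "pred_on.maxchain ?I lt (set c)"
      unfolding pred_on.maxchain_def by blast
    with so show "sorted_wrt lt c \<and> pred_on.maxchain ?I lt (set c)" by simp
  next
    assume a: "sorted_wrt lt c \<and> pred_on.maxchain ?I lt (set c)"
    then have so: "sorted_wrt lt c" and ch: "pred_on.chain ?I lt (set c)"
      and mx: "\<And>S. pred_on.chain ?I lt S \<Longrightarrow> \<not> set c \<subset> S"
      by (auto simp: pred_on.maxchain_def)
    have sI: "set c \<subseteq> ?I" using ch by (simp add: pred_on.chain_def)
    have ins: "z \<in> set c" if "z \<in> ?I" "\<forall>u\<in>set c. lt u z \<or> lt z u \<or> u = z" for z
    proof (rule ccontr)
      assume "z \<notin> set c"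
      moreover have "pred_on.chain ?I lt (insert z (set c))"
        using ch that unfolding pred_on.chain_def by auto
      ultimately show False using mx by blast
    qed
    have xc: "x \<in> set c" by (rule ins[OF xI]) (use sI in \<open>auto simp: lt_def\<close>)
    have yc: "y \<in> set c" by (rule ins[OF yI]) (use sI in \<open>auto simp: lt_def\<close>)
    have ne: "c \<noteq> []" using xc by auto
    have "hd c = x"
    proof (rule ccontr)
      assume "hd c \<noteq> x"
      then have "lt (hd c) x" using so xc by (cases c) auto
      moreover have "(x, hd c) \<in> r" using subsetD[OF sI hd_in_set[OF ne]] by simp
      ultimately show False using an unfolding lt_def by (auto dest: antisymD)
    qed
    moreover have "last c = y"
    proof (rule ccontr)
      assume "last c \<noteq> y"
      then have "lt y (last c)" using so yc by (cases c rule: rev_cases) (auto simp: sorted_wrt_append)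
      moreover have "(last c, y) \<in> r" using subsetD[OF sI last_in_set[OF ne]] by simp
      ultimately show False using an unfolding lt_def by (auto dest: antisymD)
    qed
    moreover have "covers r (c ! i) (c ! Suc i)" if i: "Suc i < length c" for i
    proof -
      have st: "lt (c ! i) (c ! Suc i)" using so i by (simp add: sorted_wrt_iff_nth_less)
      have "z = c ! i \<or> z = c ! Suc i" if z: "(c ! i, z) \<in> r" "(z, c ! Suc i) \<in> r" for z
      proof (rule ccontr)
        assume nz: "\<not> (z = c ! i \<or> z = c ! Suc i)"
        have lz: "lt (c ! i) z" "lt z (c ! Suc i)" using z nz by (auto simp: lt_def)
        have low: "lt (c ! j) z" if "j \<le> i" for j
        proof (cases "j = i")
          case False
          then have "lt (c ! j) (c ! i)" using so i that by (simp add: sorted_wrt_iff_nth_less)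
          then show ?thesis using lz(1) tlt by (meson transpD)
        qed (use lz in simp)
        have high: "lt z (c ! j)" if "Suc i \<le> j" "j < length c" for j
        proof (cases "j = Suc i")
          case False
          then have "lt (c ! Suc i) (c ! j)" using so that by (simp add: sorted_wrt_iff_nth_less)
          then show ?thesis using lz(2) tlt by (meson transpD)
        qed (use lz in simp)
        have "c ! i \<in> ?I" "c ! Suc i \<in> ?I" using subsetD[OF sI nth_mem] i by simp_all
        then have "z \<in> ?I" using z tr by (auto dest: transD)
        moreover have "lt u z \<or> lt z u" if "u \<in> set c" for u
          using that low high by (metis in_set_conv_nth not_less_eq_eq)
        ultimately have "z \<in> set c" using ins by blast
        then obtain j where "j < length c" "z = c ! j" by (metis in_set_conv_nth)
        then have "lt z z" using low[of j] high[of j] by (metis not_less_eq_eq)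
        then show False by (simp add: lt_def)
      qed
      then show ?thesis using st by (auto simp: covers_def lt_def)
    qed
    ultimately show "saturated_chain r x y c"
      using xy ne by (auto simp: saturated_chain_def successively_conv_nth)
  qed
qed

end

theory Submission
  imports Defs
begin

text \<open>
  A matching is treated as a fixed-point free involution \<open>f\<close> of \<open>{1..2n}\<close>. Let \<open>N f i j\<close> be the number
  of chords inside \<open>{i..j}\<close>. Uncrossing only increases \<open>N\<close>, and the dual order turns out to be the
  pointwise order of the functions \<open>N f\<close>; this is proved together with the shelling.

  The dual even has an edge labeling. Write a crossing as \<open>{a, c}, {b, d}\<close> with \<open>a < b < c < d\<close>.
  Replacing it by \<open>{a, b}, {c, d}\<close> (closing) gets the label \<open>(a, -d)\<close>, replacing it by
  \<open>{a, d}, {b, c}\<close> (nesting) gets \<open>(a, b)\<close>; labels are ordered lexicographically, all closing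
  labels precede the label of the edges to the adjoined element, which precedes all nesting labels.
  (These are reflections, in a reflection order of the affine symmetric group.)

  In an interval \<open>[x, y]\<close> let \<open>D = N y - N x \<ge> 0\<close>. If some \<open>D 1 j\<close> is positive, the first step is
  the closing step whose \<open>a\<close> is the first opener with \<open>D 1 (x a - 1) > 0\<close> and whose \<open>d\<close> is maximal
  subject to \<open>D 1\<close> being positive on \<open>[b, c)\<close>. If \<open>D 1\<close> vanishes, then \<open>x\<close> and \<open>y\<close> have the same
  openers, the interval is a Bruhat interval, and the usual lexicographic shelling applies. In both
  cases the least label is taken once, is followed only by larger labels, and every other first step
  can be followed by a label that is not larger; this forces unique ascending chains.
\<close>

section \<open>Edge labelings with a local condition\<close>

definition labels :: "('a \<Rightarrow> 'a \<Rightarrow> nat) \<Rightarrow> 'a list \<Rightarrow> nat list" where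
  "labels l c = map (\<lambda>(x, y). l x y) (zip c (tl c))"

lemma labels_Cons: "c \<noteq> [] \<Longrightarrow> labels l (x # c) = l x (hd c) # labels l c"
  by (cases c) (auto simp: labels_def)

lemma labels_single [simp]: "labels l [x] = []"
  by (simp add: labels_def)

lemma successively_covers_le:
  assumes "partial_order_on A r" "successively (covers r) c" "c \<noteq> []" "last c \<in> A"
  shows "(hd c, last c) \<in> r"
  using assms(2-)
proof (induction c)
  case (Cons x c)
  then show ?case
    using assms(1)
    by (cases c) (auto simp: partial_order_on_def preorder_on_def refl_on_def covers_def
      dest: transD split: if_splits)
qed simp

lemma saturated_chain_Cons:
  assumes po: "partial_order_on A r" and xy: "(x, y) \<in> r" "x \<noteq> y" and c: "saturated_chain r x y c"
  obtains z c' where "c = x # c'" "covers r x z" "saturated_chain r z y c'"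
proof -
  from c have "c \<noteq> []" "hd c = x" "last c = y" and s: "successively (covers r) c"
    by (auto simp: saturated_chain_def)
  then obtain c' where c': "c = x # c'" "c' \<noteq> []" using xy(2) by (cases c) (auto split: if_splits)
  have "y \<in> A" using xy po by (auto simp: partial_order_on_def preorder_on_def)
  moreover have "successively (covers r) c'" "covers r x (hd c')" using s c' by (cases c'; simp)+
  moreover have "last c' = y" using \<open>last c = y\<close> c' by simp
  ultimately have "saturated_chain r (hd c') y c'"
    using successively_covers_le[OF po, of c'] c' by (auto simp: saturated_chain_def)
  then show ?thesis using that c' \<open>covers r x (hd c')\<close> by blast
qed

lemma saturated_chain_refl:
  assumes po: "partial_order_on A r" and c: "saturated_chain r x x c"
  shows "c = [x]"
proof (cases c rule: remdups_adj.cases)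
  case (3 u v c')
  then have "covers r x v" "successively (covers r) (v # c')" "last (v # c') = x"
    using c by (auto simp: saturated_chain_def)
  moreover have "x \<in> A" using c po by (auto simp: saturated_chain_def partial_order_on_def preorder_on_def)
  ultimately have "(v, x) \<in> r" using successively_covers_le[OF po, of "v # c'"] by simp
  then have False using \<open>covers r x v\<close> po by (auto simp: covers_def partial_order_on_def dest: antisymD)
  then show ?thesis ..
qed (use c in \<open>auto simp: saturated_chain_def\<close>)

lemma saturated_chain_ConsI:
  assumes "partial_order_on A r" "covers r x z" "saturated_chain r z y c"
  shows "saturated_chain r x y (x # c)"
  using assms
  by (cases c) (auto simp: saturated_chain_def partial_order_on_def preorder_on_def covers_def dest: transD)

text \<open>The requirement of \<open>CL_labeling\<close> on one interval when a label depends only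
  on its edge: the root disappears, and labels are natural numbers in their usual order.\<close>

definition lex_first_ascending :: "'a rel \<Rightarrow> ('a \<Rightarrow> 'a \<Rightarrow> nat) \<Rightarrow> 'a \<Rightarrow> 'a \<Rightarrow> 'a list \<Rightarrow> bool" where
  "lex_first_ascending r l x y c \<longleftrightarrow>
     saturated_chain r x y c \<and> successively (<) (labels l c) \<and>
     (\<forall>c'. saturated_chain r x y c' \<and> c' \<noteq> c \<longrightarrow>
        \<not> successively (<) (labels l c') \<and> (labels l c, labels l c') \<in> lexord {(p, q). p < q})"

text \<open>Hypothesis \<open>EL\<close> looks only at the first two edges of a chain. The chain
  through the best atom \<open>z\<close> ascends by induction, since every label following
  \<open>l x z\<close> is larger. A chain through another atom \<open>w\<close> starts with a larger
  label, and it cannot ascend because the least label leaving \<open>w\<close> inside the interval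
  is at most \<open>l x w\<close>.\<close>

lemma lex_first_ascending_exists:
  assumes fin: "finite A" and po: "partial_order_on A r"
    and EL: "\<And>x y. (x, y) \<in> r \<Longrightarrow> x \<noteq> y \<Longrightarrow> \<exists>z. covers r x z \<and> (z, y) \<in> r \<and>
      (\<forall>w. covers r x w \<and> (w, y) \<in> r \<and> w \<noteq> z \<longrightarrow>
        l x z < l x w \<and> (\<exists>v. covers r w v \<and> (v, y) \<in> r \<and> l w v \<le> l x w)) \<and>
      (\<forall>v. covers r z v \<and> (v, y) \<in> r \<longrightarrow> l x z < l z v)"
    and xy: "(x, y) \<in> r"
  shows "\<exists>c. lex_first_ascending r l x y c"
  using xy
proof (induction "card {z. (x, z) \<in> r}" arbitrary: x rule: less_induct)
  case less
  have rA: "r \<subseteq> A \<times> A" and tr: "trans r" and an: "antisym r" and rf: "\<And>z. z \<in> A \<Longrightarrow> (z, z) \<in> r"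
    using po by (auto simp: partial_order_on_def preorder_on_def refl_on_def)
  have IH: "\<exists>c. lex_first_ascending r l z y c" if z: "(x, z) \<in> r" "x \<noteq> z" "(z, y) \<in> r" for z
  proof (rule less.hyps[OF _ z(3)])
    have "x \<in> {w. (x, w) \<in> r}" "x \<notin> {w. (z, w) \<in> r}"
      using z(1,2) rA rf an by (auto dest: antisymD)
    moreover have "{w. (z, w) \<in> r} \<subseteq> {w. (x, w) \<in> r}" using z(1) tr by (auto dest: transD)
    moreover have "finite {w. (x, w) \<in> r}" using fin rA by (auto intro: finite_subset[of _ A])
    ultimately show "card {w. (z, w) \<in> r} < card {w. (x, w) \<in> r}"
      by (metis psubsetI psubset_card_mono)
  qed
  show ?case
  proof (cases "x = y")
    case True
    then have "lex_first_ascending r l x y [x]"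
      using less.prems saturated_chain_refl[OF po] by (auto simp: lex_first_ascending_def saturated_chain_def)
    then show ?thesis ..
  next
    case False
    obtain z where z: "covers r x z" "(z, y) \<in> r"
      and other: "\<And>w. covers r x w \<Longrightarrow> (w, y) \<in> r \<Longrightarrow> w \<noteq> z \<Longrightarrow>
        l x z < l x w \<and> (\<exists>v. covers r w v \<and> (v, y) \<in> r \<and> l w v \<le> l x w)"
      and asc: "\<And>v. covers r z v \<Longrightarrow> (v, y) \<in> r \<Longrightarrow> l x z < l z v"
      using EL[OF less.prems False] by blast
    obtain c where c: "lex_first_ascending r l z y c" using IH[of z] z by (auto simp: covers_def)
    have cs: "saturated_chain r z y c" "successively (<) (labels l c)" "c \<noteq> []" "hd c = z"
      using c by (auto simp: lex_first_ascending_def saturated_chain_def)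
    have tail: "(u, y) \<in> r \<and> c' \<noteq> [] \<and> hd c' = u" if "saturated_chain r u y c'" for u c'
      using that by (auto simp: saturated_chain_def)
    have "successively (<) (labels l (x # c))"
    proof (cases "z = y")
      case True
      then have "c = [z]" using cs saturated_chain_refl[OF po] by auto
      then show ?thesis by (simp add: labels_Cons)
    next
      case False
      obtain v c' where v: "c = z # c'" "covers r z v" "saturated_chain r v y c'"
        using saturated_chain_Cons[OF po z(2) False cs(1)] .
      then show ?thesis using asc[of v] tail[of v c'] cs by (simp add: labels_Cons)
    qed
    moreover have "\<not> successively (<) (labels l c') \<and> (labels l (x # c), labels l c') \<in> lexord {(p, q). p < q}"
      if c': "saturated_chain r x y c'" "c' \<noteq> x # c" for c'
    proof -
      obtain w d where w: "c' = x # d" "covers r x w" "saturated_chain r w y d"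
        using saturated_chain_Cons[OF po less.prems False c'(1)] .
      note wd = tail[OF w(3)]
      show ?thesis
      proof (cases "w = z")
        case True
        then have "\<not> successively (<) (labels l d) \<and> (labels l c, labels l d) \<in> lexord {(p, q). p < q}"
          using c c'(2) w by (auto simp: lex_first_ascending_def)
        then show ?thesis
          using w(1) wd cs True by (auto simp: labels_Cons successively_Cons)
      next
        case False
        have lw: "l x z < l x w" using other w(2) wd False by blast
        obtain v where v: "covers r w v" "(v, y) \<in> r" "l w v \<le> l x w"
          using other w(2) wd False by blast
        obtain e where e: "lex_first_ascending r l w y e" using IH[of w] w(2) wd by (auto simp: covers_def)
        obtain g where "lex_first_ascending r l v y g"
        proof -
          have "(x, v) \<in> r" "x \<noteq> v"
            using w(2) v(1) tr an by (auto simp: covers_def dest: transD antisymD)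
          then show ?thesis using IH[of v] v(2) that by blast
        qed
        then have g: "saturated_chain r v y g" "g \<noteq> []" "hd g = v"
          by (auto simp: lex_first_ascending_def saturated_chain_def)
        have wg: "saturated_chain r w y (w # g)" using saturated_chain_ConsI[OF po v(1) g(1)] .
        \<comment> \<open>The follow-up \<open>v\<close> shows that \<open>[w, y]\<close> is
          nontrivial, so \<open>d\<close> has a first edge.\<close>
        have "w \<noteq> y" using v(1,2) an by (auto simp: covers_def dest: antisymD)
        have "\<not> successively (<) (labels l c')"
        proof
          assume sc: "successively (<) (labels l c')"
          then have "successively (<) (labels l d)" using w(1) wd by (auto simp: labels_Cons successively_Cons)
          \<comment> \<open>Only one chain of \<open>[w, y]\<close> ascends, so \<open>d\<close> is
            the distinguished one, and its first label is at most that of the chain starting with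
            \<open>w\<close>, \<open>v\<close>.\<close>
          then have d: "lex_first_ascending r l w y d" using e w(3) unfolding lex_first_ascending_def by metis
          obtain v' d' where v': "d = w # d'" "covers r w v'" "saturated_chain r v' y d'"
            using saturated_chain_Cons[OF po _ \<open>w \<noteq> y\<close> w(3)] wd by blast
          note vd' = tail[OF v'(3)]
          have "w # g = d \<or> (labels l d, labels l (w # g)) \<in> lexord {(p, q). p < q}"
            using d wg unfolding lex_first_ascending_def by metis
          then have "l w v' \<le> l w v"
            using v'(1) vd' g by (auto simp: labels_Cons)
          moreover have "l x w < l w v'" using sc w(1) v'(1) vd' by (simp add: labels_Cons)
          ultimately show False using v(3) by simp
        qed
        moreover have "(labels l (x # c), labels l c') \<in> lexord {(p, q). p < q}"
          using lw w(1) wd cs by (simp add: labels_Cons)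
        ultimately show ?thesis ..
      qed
    qed
    ultimately have "lex_first_ascending r l x y (x # c)"
      using saturated_chain_ConsI[OF po z(1) cs(1)] by (auto simp: lex_first_ascending_def)
    then show ?thesis ..
  qed
qed

text \<open>\<open>lam\<close> forgets the maximal chain, so chains with a common initial part agree
  on its labels, and the choice made inside \<open>rooted_label_seq\<close> has no effect.\<close>

lemma CL_shellable_if_edge_labeling:
  assumes fb: "finite_bounded_poset A r"
    and EL: "\<And>x y. (x, y) \<in> r \<Longrightarrow> x \<noteq> y \<Longrightarrow> \<exists>z. covers r x z \<and> (z, y) \<in> r \<and>
      (\<forall>w. covers r x w \<and> (w, y) \<in> r \<and> w \<noteq> z \<longrightarrow>
        l x z < l x w \<and> (\<exists>v. covers r w v \<and> (v, y) \<in> r \<and> l w v \<le> l x w)) \<and>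
      (\<forall>v. covers r z v \<and> (v, y) \<in> r \<longrightarrow> l x z < (l z v :: nat))"
  shows "CL_shellable A r"
proof -
  define lam :: "'a list \<times> 'a \<times> 'a \<Rightarrow> nat" where "lam = (\<lambda>(m, x, y). l x y)"
  define s :: "nat rel" where "s = {(p, q). p \<le> q}"
  have s: "s - Id = {(p, q). p < q}" by (auto simp: s_def)
  have seq: "rooted_label_seq A r lam \<rho> c = labels l c" for \<rho> c
    by (simp add: rooted_label_seq_def label_seq_def labels_def lam_def case_prod_unfold)
  have po: "finite A" "partial_order_on A r" using fb by (auto simp: finite_bounded_poset_def)
  have "CL_labeling A r UNIV s lam"
    unfolding CL_labeling_def
  proof (intro conjI allI impI)
    show "partial_order_on UNIV s"
      by (auto simp: partial_order_on_def preorder_on_def refl_on_def s_def intro: transI antisymI)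
    show "chain_edge_labeling A r UNIV lam"
      by (auto simp: chain_edge_labeling_def lam_def) (metis Suc_lessD Suc_mono nth_take lessI less_SucI)
    fix b x y \<rho> assume "is_bottom A r b \<and> (x, y) \<in> r \<and> saturated_chain r b x \<rho>"
    then obtain c where "lex_first_ascending r l x y c"
      using lex_first_ascending_exists[OF po EL] by blast
    then show "\<exists>c. saturated_chain r x y c \<and>
       successively (\<lambda>p q. (p, q) \<in> s - Id) (rooted_label_seq A r lam \<rho> c) \<and>
       (\<forall>c'. saturated_chain r x y c' \<and> c' \<noteq> c \<longrightarrow>
          \<not> successively (\<lambda>p q. (p, q) \<in> s - Id) (rooted_label_seq A r lam \<rho> c') \<and>
          (rooted_label_seq A r lam \<rho> c, rooted_label_seq A r lam \<rho> c') \<in> lexord (s - Id))"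
      unfolding lex_first_ascending_def seq s by (auto intro!: exI[of _ c])
  qed
  then show ?thesis using fb unfolding CL_shellable_def by blast
qed

section \<open>Counting nested chords\<close>

definition fpf_involution :: "nat \<Rightarrow> (nat \<Rightarrow> nat) \<Rightarrow> bool" where
  "fpf_involution n f \<longleftrightarrow> (\<forall>k\<in>{1..2*n}. f k \<in> {1..2*n} \<and> f k \<noteq> k \<and> f (f k) = k)"

text \<open>Summing over points with \<open>u < f u\<close> counts each chord once, at its opener.
  Integer values let counts be subtracted freely.\<close>

definition chords :: "nat \<Rightarrow> (nat \<Rightarrow> nat) \<Rightarrow> (nat \<Rightarrow> nat \<Rightarrow> bool) \<Rightarrow> int" where
  "chords n f P = (\<Sum>u\<in>{1..2*n}. of_bool (u < f u \<and> P u (f u)))"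

abbreviation nests :: "nat \<Rightarrow> (nat \<Rightarrow> nat) \<Rightarrow> nat \<Rightarrow> nat \<Rightarrow> int" where
  "nests n f i j \<equiv> chords n f (\<lambda>u v. i \<le> u \<and> v \<le> j)"

text \<open>Uncrossing raises nesting counts, so this compares matchings in the direction of the
  dual poset.\<close>

definition nest_le :: "nat \<Rightarrow> (nat \<Rightarrow> nat) \<Rightarrow> (nat \<Rightarrow> nat) \<Rightarrow> bool" where
  "nest_le n x y \<longleftrightarrow> (\<forall>i j. nests n x i j \<le> nests n y i j)"

lemma fpf_involutionD:
  assumes "fpf_involution n f" "k \<in> {1..2*n}"
  shows "f k \<in> {1..2*n}" "f k \<noteq> k" "f (f k) = k"
  using assms by (auto simp: fpf_involution_def)

lemma chords_mono:
  assumes "\<And>u. u \<in> {1..2*n} \<Longrightarrow> u < f u \<Longrightarrow> P u (f u) \<Longrightarrow> Q u (f u)"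
  shows "chords n f P \<le> chords n f Q"
  unfolding chords_def by (rule sum_mono) (use assms in auto)

lemma chords_cong:
  assumes "\<And>u. u \<in> {1..2*n} \<Longrightarrow> u < f u \<Longrightarrow> P u (f u) \<longleftrightarrow> Q u (f u)"
  shows "chords n f P = chords n f Q"
  unfolding chords_def by (rule sum.cong) (use assms in auto)

lemma chords_split:
  assumes "\<And>u. u \<in> {1..2*n} \<Longrightarrow> u < f u \<Longrightarrow>
    P u (f u) \<longleftrightarrow> Q u (f u) \<or> R u (f u)"
    and "\<And>u. u \<in> {1..2*n} \<Longrightarrow> u < f u \<Longrightarrow> Q u (f u) \<Longrightarrow> \<not> R u (f u)"
  shows "chords n f P = chords n f Q + chords n f R"
  unfolding chords_def sum.distrib[symmetric]
  by (rule sum.cong) (use assms in auto)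

lemma chords_pos_iff: "chords n f P > 0 \<longleftrightarrow> (\<exists>u\<in>{1..2*n}. u < f u \<and> P u (f u))"
proof -
  have "chords n f P \<ge> 0" unfolding chords_def by (rule sum_nonneg) simp
  moreover have "chords n f P = 0 \<longleftrightarrow> (\<forall>u\<in>{1..2*n}. \<not> (u < f u \<and> P u (f u)))"
    unfolding chords_def by (subst sum_nonneg_eq_0_iff) auto
  ultimately show ?thesis by auto
qed

text \<open>Each point of \<open>{1..j}\<close> either opens or closes a chord, and the closers
  among them belong to the chords nested in the prefix. Reindexing the sum by \<open>f\<close> moves
  the count of these chords from openers to closers.\<close>

lemma openers_plus_closers:
  assumes f: "fpf_involution n f" and j: "j \<le> 2*n"
  shows "chords n f (\<lambda>u v. u \<le> j) + nests n f 1 j = int j"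
proof -
  have "bij_betw f {1..2*n} {1..2*n}"
    by (rule bij_betw_byWitness[where f' = f]) (use f in \<open>auto simp: fpf_involution_def\<close>)
  then have "(\<Sum>k\<in>{1..2*n}. of_bool (f (f k) < f k \<and> f k \<le> j)) = (\<Sum>k\<in>{1..2*n}. of_bool (f k < k \<and> k \<le> j) :: int)"
    by (rule sum.reindex_bij_betw)
  moreover have "nests n f 1 j = (\<Sum>k\<in>{1..2*n}. of_bool (f (f k) < f k \<and> f k \<le> j))"
    unfolding chords_def by (rule sum.cong) (use f in \<open>auto simp: fpf_involution_def\<close>)
  ultimately have "chords n f (\<lambda>u v. u \<le> j) + nests n f 1 j = (\<Sum>k\<in>{1..2*n}. of_bool (k < f k \<and> k \<le> j) + of_bool (f k < k \<and> k \<le> j))"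
    by (simp add: chords_def sum.distrib)
  also have "\<dots> = (\<Sum>k\<in>{1..2*n}. of_bool (k \<le> j))"
    by (rule sum.cong) (use fpf_involutionD(2)[OF f] in \<open>auto simp: neq_iff\<close>)
  also have "\<dots> = (\<Sum>k\<in>{1..j}. 1)"
    by (rule sum.mono_neutral_cong_right) (use j in auto)
  finally show ?thesis by simp
qed

lemma nests_total:
  assumes "fpf_involution n f" shows "nests n f 1 (2*n) = int n"
proof -
  have "chords n f (\<lambda>u v. u \<le> 2*n) = nests n f 1 (2*n)"
    by (rule chords_cong) (use assms in \<open>auto simp: fpf_involution_def\<close>)
  then show ?thesis using openers_plus_closers[OF assms, of "2*n"] by simp
qed

text \<open>A chord that does not open in \<open>{1..j}\<close> lies wholly in the suffix. Prefix
  and suffix counts therefore differ by the same amount for every matching, and a surplus in one is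
  a surplus in the other.\<close>

lemma nests_suffix:
  assumes f: "fpf_involution n f" and j: "j \<le> 2*n"
  shows "nests n f (Suc j) (2*n) = int n - int j + nests n f 1 j"
proof -
  have "nests n f 1 (2*n) = chords n f (\<lambda>u v. u \<le> j) + nests n f (Suc j) (2*n)"
    by (rule chords_split) (use f in \<open>auto simp: fpf_involution_def\<close>)
  then show ?thesis using openers_plus_closers[OF f j] nests_total[OF f] by simp
qed

section \<open>The two uncrossing moves and their effect on nesting counts\<close>

definition close_crossing :: "(nat \<Rightarrow> nat) \<Rightarrow> nat \<Rightarrow> nat \<Rightarrow> nat \<Rightarrow> nat" where
  "close_crossing f a b = f(a := b, b := a, f a := f b, f b := f a)"

definition nest_crossing :: "(nat \<Rightarrow> nat) \<Rightarrow> nat \<Rightarrow> nat \<Rightarrow> nat \<Rightarrow> nat" where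
  "nest_crossing f a b = f(a := f b, f b := a, b := f a, f a := b)"

definition crossing :: "nat \<Rightarrow> (nat \<Rightarrow> nat) \<Rightarrow> nat \<Rightarrow> nat \<Rightarrow> bool" where
  "crossing n f a b \<longleftrightarrow> a \<in> {1..2*n} \<and> b \<in> {1..2*n} \<and> a < b \<and> b < f a \<and> f a < f b"

lemma crossingD:
  assumes "crossing n f a b" "fpf_involution n f"
  shows "a < b" "b < f a" "f a < f b" "a \<in> {1..2*n}" "b \<in> {1..2*n}" "f a \<in> {1..2*n}" "f b \<in> {1..2*n}"
    "f (f a) = a" "f (f b) = b"
  using assms by (auto simp: crossing_def fpf_involution_def)

lemma crossing_distinct:
  assumes "crossing n f a b"
  shows "a \<noteq> b" "a \<noteq> f a" "a \<noteq> f b" "b \<noteq> f a" "b \<noteq> f b" "f a \<noteq> f b"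
  using assms by (auto simp: crossing_def)

lemma close_crossing_simps:
  assumes "crossing n f a b"
  shows "close_crossing f a b a = b" "close_crossing f a b b = a"
    "close_crossing f a b (f a) = f b" "close_crossing f a b (f b) = f a"
  using crossing_distinct[OF assms] by (simp_all add: close_crossing_def)

lemma nest_crossing_simps:
  assumes "crossing n f a b"
  shows "nest_crossing f a b a = f b" "nest_crossing f a b b = f a"
    "nest_crossing f a b (f a) = b" "nest_crossing f a b (f b) = a"
  using crossing_distinct[OF assms] by (simp_all add: nest_crossing_def)

lemma crossing_update_other:
  assumes "u \<notin> {a, b, f a, f b}"
  shows "close_crossing f a b u = f u" "nest_crossing f a b u = f u"
  using assms by (simp_all add: close_crossing_def nest_crossing_def)

lemma fpf_involution_close_crossing:
  assumes c: "crossing n f a b" and f: "fpf_involution n f"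
  shows "fpf_involution n (close_crossing f a b)"
  unfolding fpf_involution_def
proof
  fix k assume k: "k \<in> {1..2*n}"
  note D = crossingD[OF c f]
  note ne = crossing_distinct[OF c]
  let ?g = "close_crossing f a b"
  note g = close_crossing_simps[OF c]
  show "?g k \<in> {1..2*n} \<and> ?g k \<noteq> k \<and> ?g (?g k) = k"
  proof (cases "k \<in> {a, b, f a, f b}")
    case True
    from True show ?thesis
      by (elim insertE emptyE) (simp_all add: g ne ne[symmetric] D(4-7) del: atLeastAtMost_iff One_nat_def)
  next
    case False
    have "f k \<noteq> a" "f k \<noteq> b" "f k \<noteq> f a" "f k \<noteq> f b"
      using False fpf_involutionD(3)[OF f k] D(8,9) by (metis insertI1 insertI2)+
    then show ?thesis
      using False fpf_involutionD[OF f k] by (simp add: close_crossing_def)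
  qed
qed

lemma fpf_involution_nest_crossing:
  assumes c: "crossing n f a b" and f: "fpf_involution n f"
  shows "fpf_involution n (nest_crossing f a b)"
  unfolding fpf_involution_def
proof
  fix k assume k: "k \<in> {1..2*n}"
  note D = crossingD[OF c f]
  note ne = crossing_distinct[OF c]
  let ?g = "nest_crossing f a b"
  note g = nest_crossing_simps[OF c]
  show "?g k \<in> {1..2*n} \<and> ?g k \<noteq> k \<and> ?g (?g k) = k"
  proof (cases "k \<in> {a, b, f a, f b}")
    case True
    from True show ?thesis
      by (elim insertE emptyE) (simp_all add: g ne ne[symmetric] D(4-7) del: atLeastAtMost_iff One_nat_def)
  next
    case False
    have "f k \<noteq> a" "f k \<noteq> b" "f k \<noteq> f a" "f k \<noteq> f b"
      using False fpf_involutionD(3)[OF f k] D(8,9) by (metis insertI1 insertI2)+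
    then show ?thesis
      using False fpf_involutionD[OF f k] by (simp add: nest_crossing_def)
  qed
qed

lemma chords_change:
  assumes "T \<subseteq> {1..2*n}" "\<And>u. u \<notin> T \<Longrightarrow> g u = f u"
  shows "chords n g P = chords n f P +
    (\<Sum>u\<in>T. of_bool (u < g u \<and> P u (g u)) - of_bool (u < f u \<and> P u (f u)))"
proof -
  have "chords n g P - chords n f P =
    (\<Sum>u\<in>{1..2*n}. of_bool (u < g u \<and> P u (g u)) - of_bool (u < f u \<and> P u (f u)))"
    by (simp add: chords_def sum_subtractf)
  also have "\<dots> = (\<Sum>u\<in>T. of_bool (u < g u \<and> P u (g u)) - of_bool (u < f u \<and> P u (f u)))"
    by (rule sum.mono_neutral_right) (use assms in auto)
  finally show ?thesis by simp
qed

lemma sum_four: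
  fixes h :: "'a \<Rightarrow> int"
  assumes "a \<noteq> b" "a \<noteq> c" "a \<noteq> d" "b \<noteq> c" "b \<noteq> d" "c \<noteq> d"
  shows "sum h {a, b, c, d} = h a + h b + h c + h d"
  using assms by simp

text \<open>Let \<open>c = f a\<close> and \<open>d = f b\<close>. The chord \<open>{a, b}\<close>
  is gained, but its gain is cancelled by the loss of \<open>{a, c}\<close> once
  \<open>c \<le> j\<close>; the gain of \<open>{c, d}\<close> is cancelled by the loss of
  \<open>{b, d}\<close> when \<open>i \<le> b\<close>. Two disjoint rectangles of pairs
  \<open>(i, j)\<close> remain.\<close>

lemma nests_close_crossing:
  assumes c: "crossing n f a b" and f: "fpf_involution n f"
  shows "nests n (close_crossing f a b) i j = nests n f i j + of_bool (i \<le> a \<and> b \<le> j \<and> j < f a) + of_bool (b < i \<and> i \<le> f a \<and> f b \<le> j)"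
proof -
  note D = crossingD[OF c f]
  note ne = crossing_distinct[OF c]
  let ?g = "close_crossing f a b"
  have "nests n ?g i j = nests n f i j +
    (\<Sum>u\<in>{a, b, f a, f b}. of_bool (u < ?g u \<and> i \<le> u \<and> ?g u \<le> j) - of_bool (u < f u \<and> i \<le> u \<and> f u \<le> j))"
    by (rule chords_change) (use D(4-7) crossing_update_other(1) in blast)+
  also have "\<dots> = nests n f i j + (of_bool (i \<le> a \<and> b \<le> j \<and> j < f a) + of_bool (b < i \<and> i \<le> f a \<and> f b \<le> j))"
  proof -
    obtain c d where cd: "f a = c" "f b = d" by blast
    have lt: "a < b" "b < c" "c < d" using D(1-3) cd by simp_all
    \<comment> \<open>The formula is checked for each position of \<open>i\<close> and
      \<open>j\<close> relative to \<open>a < b < c < d\<close>.\<close>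
    have i: "i \<le> a \<or> a < i \<and> i \<le> b \<or> b < i \<and> i \<le> c \<or> c < i" by linarith
    have j: "j < b \<or> b \<le> j \<and> j < c \<or> c \<le> j \<and> j < d \<or> d \<le> j" by linarith
    show ?thesis
      unfolding close_crossing_simps[OF c] sum_four[OF ne]
      unfolding D(8,9) close_crossing_simps[OF c]
      unfolding cd using i j lt by (elim disjE conjE) simp_all
  qed
  finally show ?thesis by simp
qed

text \<open>The gains and losses of the four chords factor into a condition on \<open>i\<close>
  alone and one on \<open>j\<close> alone. As \<open>a \<ge> 1\<close>, counts with
  \<open>i = 1\<close> never change, so nesting keeps the set of openers.\<close>

lemma nests_nest_crossing:
  assumes c: "crossing n f a b" and f: "fpf_involution n f"
  shows "nests n (nest_crossing f a b) i j = nests n f i j + of_bool (a < i \<and> i \<le> b \<and> f a \<le> j \<and> j < f b)"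
proof -
  note D = crossingD[OF c f]
  note ne = crossing_distinct[OF c]
  let ?g = "nest_crossing f a b"
  have "nests n ?g i j = nests n f i j +
    (\<Sum>u\<in>{a, b, f a, f b}. of_bool (u < ?g u \<and> i \<le> u \<and> ?g u \<le> j) - of_bool (u < f u \<and> i \<le> u \<and> f u \<le> j))"
    by (rule chords_change) (use D(4-7) crossing_update_other(2) in blast)+
  also have "\<dots> = nests n f i j + (of_bool (a < i \<and> i \<le> b \<and> f a \<le> j \<and> j < f b))"
  proof -
    obtain c d where cd: "f a = c" "f b = d" by blast
    have lt: "a < b" "b < c" "c < d" using D(1-3) cd by simp_all
    have i: "i \<le> a \<or> a < i \<and> i \<le> b \<or> b < i \<and> i \<le> c \<or> c < i" by linarith
    have j: "j < b \<or> b \<le> j \<and> j < c \<or> c \<le> j \<and> j < d \<or> d \<le> j" by linarith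
    show ?thesis
      unfolding nest_crossing_simps[OF c] sum_four[OF ne]
      unfolding D(8,9) nest_crossing_simps[OF c]
      unfolding cd using i j lt by (elim disjE conjE) simp_all
  qed
  finally show ?thesis by simp
qed

section \<open>The number of crossings lost by a move\<close>

definition crossings :: "nat \<Rightarrow> (nat \<Rightarrow> nat) \<Rightarrow> int" where
  "crossings n f = (\<Sum>u\<in>{1..2*n}. \<Sum>v\<in>{1..2*n}. of_bool (u < v \<and> v < f u \<and> f u < f v))"

lemma double_sum_split:
  fixes K :: "'a \<Rightarrow> 'a \<Rightarrow> int"
  assumes "finite S" "T \<subseteq> S"
  shows "(\<Sum>u\<in>S. \<Sum>v\<in>S. K u v) = (\<Sum>u\<in>S - T. \<Sum>v\<in>S - T. K u v) +
    (\<Sum>u\<in>S - T. \<Sum>t\<in>T. K u t + K t u) + (\<Sum>s\<in>T. \<Sum>t\<in>T. K s t)"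
proof -
  have *: "sum h S = sum h (S - T) + sum h T" for h :: "'a \<Rightarrow> int"
    using sum.subset_diff[OF assms(2,1)] .
  have "(\<Sum>t\<in>T. \<Sum>u\<in>S - T. K t u) = (\<Sum>u\<in>S - T. \<Sum>t\<in>T. K t u)" by (rule sum.swap)
  then show ?thesis by (simp add: * sum.distrib)
qed

text \<open>In use, \<open>T\<close> holds the four ends of the two strands involved. Inside
  \<open>T\<close> one crossing is lost (\<open>TT\<close>); each outside point \<open>u\<close>
  accounts for a loss of two or none (\<open>RT\<close>). The total loss is one plus twice the
  number of \<open>u\<close> with \<open>B u\<close>.\<close>

lemma crossings_change:
  assumes T: "T \<subseteq> {1..2*n}" and g: "\<And>u. u \<notin> T \<Longrightarrow> g u = f u"
    and TT: "(\<Sum>s\<in>T. \<Sum>t\<in>T. of_bool (s < t \<and> t < f s \<and> f s < f t)) =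
      (\<Sum>s\<in>T. \<Sum>t\<in>T. of_bool (s < t \<and> t < g s \<and> g s < g t)) + (1 :: int)"
    and RT: "\<And>u. u \<in> {1..2*n} - T \<Longrightarrow>
      (\<Sum>t\<in>T. of_bool (u < t \<and> t < f u \<and> f u < f t) + of_bool (t < u \<and> u < f t \<and> f t < f u)) =
      (\<Sum>t\<in>T. of_bool (u < t \<and> t < f u \<and> f u < g t) + of_bool (t < u \<and> u < g t \<and> g t < f u)) +
      (2 * of_bool (B u) :: int)"
  shows "crossings n g = crossings n f - 1 \<longleftrightarrow> (\<forall>u\<in>{1..2*n} - T. \<not> B u)"
proof -
  let ?S = "{1..2*n}"
  have "crossings n f - crossings n g - 1 =
    (\<Sum>u\<in>?S - T. (\<Sum>t\<in>T. of_bool (u < t \<and> t < f u \<and> f u < f t) + of_bool (t < u \<and> u < f t \<and> f t < f u)) -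
      (\<Sum>t\<in>T. of_bool (u < t \<and> t < f u \<and> f u < g t) + of_bool (t < u \<and> u < g t \<and> g t < f u)))"
    unfolding crossings_def double_sum_split[OF finite_atLeastAtMost T] TT sum_subtractf
    by (simp add: g)
  also have "\<dots> = (\<Sum>u\<in>?S - T. 2 * of_bool (B u))"
    by (rule sum.cong) (use RT in auto)
  finally have "crossings n f - crossings n g - 1 = (\<Sum>u\<in>?S - T. 2 * of_bool (B u))" .
  moreover have "(\<Sum>u\<in>?S - T. 2 * of_bool (B u)) = (0 :: int) \<longleftrightarrow> (\<forall>u\<in>?S - T. \<not> B u)"
    by (subst sum_nonneg_eq_0_iff) auto
  ultimately show ?thesis by (metis add_diff_cancel_left' diff_diff_eq diff_eq_eq eq_iff_diff_eq_0)
qed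

text \<open>A third strand with one end strictly between \<open>b\<close> and \<open>f a\<close> and
  the other outside \<open>{a..f b}\<close> crosses both old strands and neither new one. Every
  other strand keeps its number of crossings.\<close>

lemma crossings_close_crossing:
  assumes c: "crossing n f a b" and f: "fpf_involution n f"
  shows "crossings n (close_crossing f a b) = crossings n f - 1 \<longleftrightarrow>
    (\<forall>p\<in>{1..2*n}. b < p \<longrightarrow> p < f a \<longrightarrow> a \<le> f p \<and> f p \<le> f b)"
proof -
  note D = crossingD[OF c f]
  \<comment> \<open>\<open>B\<close> is evaluated at openers, so its two disjuncts distinguish
    whether the end in the middle is the closer or the opener.\<close>
  define B where "B = (\<lambda>u. u < f u \<and> (u < a \<and> b < f u \<and> f u < f a \<or> b < u \<and> u < f a \<and> f b < f u))"
  let ?g = "close_crossing f a b"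
  let ?T = "{a, b, f a, f b}"
  note ne = crossing_distinct[OF c]
  have "crossings n (close_crossing f a b) = crossings n f - 1 \<longleftrightarrow>
    (\<forall>u\<in>{1..2*n} - {a, b, f a, f b}. \<not> B u)"
  proof (rule crossings_change)
    fix u assume u: "u \<in> {1..2*n} - {a, b, f a, f b}"
    then have v: "f u \<notin> {a, b, f a, f b}" using D fpf_involutionD[OF f, of u] by auto
    obtain c d q where cd: "f a = c" "f b = d" "f u = q" by blast
    have lt: "a < b" "b < c" "c < d" using D(1-3) cd by simp_all
    have p: "u < a \<or> a < u \<and> u < b \<or> b < u \<and> u < c \<or> c < u \<and> u < d \<or> d < u"
      using u cd by force
    have q: "q < a \<or> a < q \<and> q < b \<or> b < q \<and> q < c \<or> c < q \<and> q < d \<or> d < q"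
      using v cd by force
    show "(\<Sum>t\<in>{a, b, f a, f b}. of_bool (u < t \<and> t < f u \<and> f u < f t) + of_bool (t < u \<and> u < f t \<and> f t < f u)) =
      (\<Sum>t\<in>{a, b, f a, f b}. of_bool (u < t \<and> t < f u \<and> f u < close_crossing f a b t) +
         of_bool (t < u \<and> u < close_crossing f a b t \<and> close_crossing f a b t < f u)) + (2 * of_bool (B u) :: int)"
      unfolding close_crossing_simps[OF c] sum_four[OF ne] B_def
      unfolding D(8,9) close_crossing_simps[OF c]
      unfolding cd using lt p q by (elim disjE conjE) simp_all
  next
    show "(\<Sum>s\<in>?T. \<Sum>t\<in>?T. of_bool (s < t \<and> t < f s \<and> f s < f t)) =
      (\<Sum>s\<in>?T. \<Sum>t\<in>?T. of_bool (s < t \<and> t < ?g s \<and> ?g s < ?g t)) + (1 :: int)"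
      unfolding sum_four[OF ne] close_crossing_simps[OF c] D(8,9) using D(1-3) by simp
  qed (use D(4-7) crossing_update_other in auto)
  also have "\<dots> \<longleftrightarrow> (\<forall>p\<in>{1..2*n}. b < p \<longrightarrow> p < f a \<longrightarrow> a \<le> f p \<and> f p \<le> f b)"
  proof
    assume *: "\<forall>u\<in>{1..2*n} - {a, b, f a, f b}. \<not> B u"
    show "\<forall>p\<in>{1..2*n}. b < p \<longrightarrow> p < f a \<longrightarrow> a \<le> f p \<and> f p \<le> f b"
    proof (intro ballI impI)
      fix p assume p: "p \<in> {1..2*n}" "b < p" "p < f a"
      have pn: "p \<notin> {a, b, f a, f b}" "f p \<notin> {a, b, f a, f b}"
        using p D fpf_involutionD[OF f p(1)] by auto
      then show "a \<le> f p \<and> f p \<le> f b"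
        using *[rule_format, of p] *[rule_format, of "f p"] p D fpf_involutionD[OF f p(1)]
        by (auto simp: B_def)
    qed
  next
    assume *: "\<forall>p\<in>{1..2*n}. b < p \<longrightarrow> p < f a \<longrightarrow> a \<le> f p \<and> f p \<le> f b"
    show "\<forall>u\<in>{1..2*n} - {a, b, f a, f b}. \<not> B u"
    proof
      fix u assume u: "u \<in> {1..2*n} - {a, b, f a, f b}"
      then show "\<not> B u"
        using *[rule_format, of u] *[rule_format, of "f u"] fpf_involutionD[OF f, of u] by (auto simp: B_def)
    qed
  qed
  finally show ?thesis .
qed

text \<open>Here the third strands that lose both crossings are those joining a point between
  \<open>a\<close> and \<open>b\<close> to a point between \<open>f a\<close> and
  \<open>f b\<close>.\<close>

lemma crossings_nest_crossing:
  assumes c: "crossing n f a b" and f: "fpf_involution n f"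
  shows "crossings n (nest_crossing f a b) = crossings n f - 1 \<longleftrightarrow>
    (\<forall>p\<in>{1..2*n}. a < p \<longrightarrow> p < b \<longrightarrow> f p < f a \<or> f b < f p)"
proof -
  note D = crossingD[OF c f]
  define B where "B = (\<lambda>u. a < u \<and> u < b \<and> f a < f u \<and> f u < f b)"
  let ?g = "nest_crossing f a b"
  let ?T = "{a, b, f a, f b}"
  note ne = crossing_distinct[OF c]
  have "crossings n (nest_crossing f a b) = crossings n f - 1 \<longleftrightarrow>
    (\<forall>u\<in>{1..2*n} - {a, b, f a, f b}. \<not> B u)"
  proof (rule crossings_change)
    fix u assume u: "u \<in> {1..2*n} - {a, b, f a, f b}"
    then have v: "f u \<notin> {a, b, f a, f b}" using D fpf_involutionD[OF f, of u] by auto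
    obtain c d q where cd: "f a = c" "f b = d" "f u = q" by blast
    have lt: "a < b" "b < c" "c < d" using D(1-3) cd by simp_all
    have p: "u < a \<or> a < u \<and> u < b \<or> b < u \<and> u < c \<or> c < u \<and> u < d \<or> d < u"
      using u cd by force
    have q: "q < a \<or> a < q \<and> q < b \<or> b < q \<and> q < c \<or> c < q \<and> q < d \<or> d < q"
      using v cd by force
    show "(\<Sum>t\<in>{a, b, f a, f b}. of_bool (u < t \<and> t < f u \<and> f u < f t) + of_bool (t < u \<and> u < f t \<and> f t < f u)) =
      (\<Sum>t\<in>{a, b, f a, f b}. of_bool (u < t \<and> t < f u \<and> f u < nest_crossing f a b t) +
         of_bool (t < u \<and> u < nest_crossing f a b t \<and> nest_crossing f a b t < f u)) + (2 * of_bool (B u) :: int)"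
      unfolding nest_crossing_simps[OF c] sum_four[OF ne] B_def
      unfolding D(8,9) nest_crossing_simps[OF c]
      unfolding cd using lt p q by (elim disjE conjE) simp_all
  next
    show "(\<Sum>s\<in>?T. \<Sum>t\<in>?T. of_bool (s < t \<and> t < f s \<and> f s < f t)) =
      (\<Sum>s\<in>?T. \<Sum>t\<in>?T. of_bool (s < t \<and> t < ?g s \<and> ?g s < ?g t)) + (1 :: int)"
      unfolding sum_four[OF ne] nest_crossing_simps[OF c] D(8,9) using D(1-3) by simp
  qed (use D(4-7) crossing_update_other in auto)
  also have "\<dots> \<longleftrightarrow> (\<forall>p\<in>{1..2*n}. a < p \<longrightarrow> p < b \<longrightarrow> f p < f a \<or> f b < f p)"
  proof
    assume *: "\<forall>u\<in>{1..2*n} - {a, b, f a, f b}. \<not> B u"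
    show "\<forall>p\<in>{1..2*n}. a < p \<longrightarrow> p < b \<longrightarrow> f p < f a \<or> f b < f p"
    proof (intro ballI impI)
      fix p assume p: "p \<in> {1..2*n}" "a < p" "p < b"
      then have "p \<notin> {a, b, f a, f b}" "f p \<notin> {a, b, f a, f b}"
        using D fpf_involutionD[OF f p(1)] by auto
      then show "f p < f a \<or> f b < f p" using *[rule_format, of p] p by (auto simp: B_def)
    qed
  qed (auto simp: B_def)
  finally show ?thesis .
qed

section \<open>Closing steps\<close>

lemma nests_split_row:
  "nests n f 1 j = chords n f (\<lambda>u v. u < i \<and> v \<le> j) + nests n f i j"
  by (rule chords_split) auto

lemma nests_zero: "j \<le> i \<Longrightarrow> nests n f i j = 0"
  unfolding chords_def by (rule sum.neutral) auto

text \<open>Otherwise \<open>y\<close> has more chords than \<open>x\<close> that open in \<open>{1..i}\<close> and close by \<open>j\<close>. Moving \<open>j\<close> up to just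
  before the next partner of an opener in \<open>{1..i}\<close> keeps this surplus, and there it contradicts the
  hypothesis.\<close>

lemma slack_rows:
  assumes x: "fpf_involution n x" and y: "fpf_involution n y" and le: "nest_le n x y"
    and i: "i \<le> 2 * n"
    and small: "\<And>a. 1 \<le> a \<Longrightarrow> a \<le> i \<Longrightarrow> a < x a \<Longrightarrow> nests n y 1 (x a - 1) \<le> nests n x 1 (x a - 1)"
  shows "nests n y 1 j - nests n x 1 j \<le> nests n y (Suc i) j - nests n x (Suc i) j"
proof (rule ccontr)
  let ?c = "\<lambda>f j. chords n f (\<lambda>u v. u < Suc i \<and> v \<le> j)"
  assume "\<not> ?thesis"
  then have lt: "?c x j < ?c y j"
    using nests_split_row[of n x j "Suc i"] nests_split_row[of n y j "Suc i"] by linarith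
  show False
  proof (cases "\<exists>u. 1 \<le> u \<and> u \<le> i \<and> u < x u \<and> j < x u")
    case True
    define c where "c = (LEAST c. \<exists>u. 1 \<le> u \<and> u \<le> i \<and> u < x u \<and> j < x u \<and> x u = c)"
    have "\<exists>u. 1 \<le> u \<and> u \<le> i \<and> u < x u \<and> j < x u \<and> x u = c"
      unfolding c_def by (rule LeastI_ex) (use True in blast)
    then obtain u where u: "1 \<le> u" "u \<le> i" "u < x u" "j < c" "x u = c" by auto
    have least: "c \<le> x u" if "1 \<le> u" "u \<le> i" "u < x u" "j < x u" for u
      unfolding c_def by (rule Least_le) (use that in blast)
    have "?c x (c - 1) = ?c x j"
    proof (rule chords_cong)
      fix u assume "u \<in> {1..2*n}" "u < x u"
      then show "u < Suc i \<and> x u \<le> c - 1 \<longleftrightarrow> u < Suc i \<and> x u \<le> j"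
        using least[of u] \<open>j < c\<close> by (cases "j < x u") auto
    qed
    moreover have "?c y j \<le> ?c y (c - 1)" by (rule chords_mono) (use \<open>j < c\<close> in auto)
    moreover have "nests n y 1 (c - 1) \<le> nests n x 1 (c - 1)" using small[of u] u by simp
    moreover have "nests n x (Suc i) (c - 1) \<le> nests n y (Suc i) (c - 1)"
      using le by (simp add: nest_le_def)
    ultimately show False
      using lt nests_split_row[of n x "c - 1" "Suc i"] nests_split_row[of n y "c - 1" "Suc i"] by linarith
  next
    case False
    \<comment> \<open>No strand of \<open>x\<close> opening in \<open>{1..i}\<close> passes beyond
      \<open>j\<close>, so the count for \<open>x\<close> is the number of all its openers there.
      Since prefix counts of \<open>y\<close> are at least those of \<open>x\<close>,
      \<open>y\<close> has no more openers in \<open>{1..i}\<close>.\<close>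
    have "?c x j = chords n x (\<lambda>u v. u \<le> i)"
      by (rule chords_cong) (use False in \<open>auto simp: less_Suc_eq_le not_less\<close>)
    moreover have "?c y j \<le> chords n y (\<lambda>u v. u \<le> i)"
      by (rule chords_mono) auto
    moreover have "nests n x 1 i \<le> nests n y 1 i" using le by (simp add: nest_le_def)
    ultimately show False
      using lt openers_plus_closers[OF x i] openers_plus_closers[OF y i] by linarith
  qed
qed

text \<open>The target \<open>t\<close> is the upper end of an interval of the dual poset; \<open>None\<close> stands for the adjoined
  element, which imposes no condition.\<close>

definition below :: "nat \<Rightarrow> (nat \<Rightarrow> nat) \<Rightarrow> (nat \<Rightarrow> nat) option \<Rightarrow> bool" where
  "below n x t \<longleftrightarrow> (\<forall>y. t = Some y \<longrightarrow> fpf_involution n y \<and> nest_le n x y)"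

text \<open>Room for one more chord in the prefix \<open>{1..j}\<close>. Closing at
  \<open>(a, b)\<close> consumes it exactly for \<open>j\<close> in
  \<open>{b..<x a}\<close>.\<close>

definition slack :: "nat \<Rightarrow> (nat \<Rightarrow> nat) \<Rightarrow> (nat \<Rightarrow> nat) option \<Rightarrow> nat \<Rightarrow> bool" where
  "slack n x t j \<longleftrightarrow> (\<forall>y. t = Some y \<longrightarrow> nests n x 1 j < nests n y 1 j)"

text \<open>The prefix part of the requirement that closing stays below \<open>t\<close>. Third
  strands and counts with \<open>i > 1\<close> are ignored; the extreme closable pair turns out to
  satisfy those conditions too.\<close>

definition closable :: "nat \<Rightarrow> (nat \<Rightarrow> nat) \<Rightarrow> (nat \<Rightarrow> nat) option \<Rightarrow> nat \<Rightarrow> nat \<Rightarrow> bool" where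
  "closable n x t a b \<longleftrightarrow> crossing n x a b \<and> (\<forall>j\<in>{b..<x a}. slack n x t j)"

text \<open>The conditions on \<open>p\<close> say that no third chord crosses both strands, so that exactly one crossing
  is lost.\<close>

definition closing :: "nat \<Rightarrow> (nat \<Rightarrow> nat) \<Rightarrow> nat \<Rightarrow> nat \<Rightarrow> bool" where
  "closing n f a b \<longleftrightarrow> crossing n f a b \<and>
     (\<forall>p\<in>{1..2*n}. b < p \<longrightarrow> p < f a \<longrightarrow> a \<le> f p \<and> f p \<le> f b)"

definition nesting :: "nat \<Rightarrow> (nat \<Rightarrow> nat) \<Rightarrow> nat \<Rightarrow> nat \<Rightarrow> bool" where
  "nesting n f a b \<longleftrightarrow> crossing n f a b \<and>
     (\<forall>p\<in>{1..2*n}. a < p \<longrightarrow> p < b \<longrightarrow> f p < f a \<or> f b < f p)"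

lemma closing_closable:
  assumes x: "fpf_involution n x" and c: "closing n x a b" and b: "below n (close_crossing x a b) t"
  shows "closable n x t a b"
proof -
  have cr: "crossing n x a b" using c by (simp add: closing_def)
  have "slack n x t j" if "j \<in> {b..<x a}" for j
  proof -
    have "nests n (close_crossing x a b) 1 j = nests n x 1 j + 1"
      using that crossingD[OF cr x] by (simp add: nests_close_crossing[OF cr x])
    moreover have "nests n (close_crossing x a b) 1 j \<le> nests n y 1 j" if "t = Some y" for y
      using b that unfolding below_def nest_le_def by blast
    ultimately show ?thesis unfolding slack_def by fastforce
  qed
  then show ?thesis using cr by (simp add: closable_def)
qed

lemma slack_close_crossing:
  assumes x: "fpf_involution n x" and c: "crossing n x a b"
  shows "slack n (close_crossing x a b) t j \<Longrightarrow> slack n x t j"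
    and "j < b \<or> x a \<le> j \<Longrightarrow> slack n (close_crossing x a b) t j \<longleftrightarrow> slack n x t j"
  using nests_close_crossing[OF c x, of 1 j] crossingD(4)[OF c x] crossingD(1)[OF c x]
  by (auto simp: slack_def of_bool_def split: if_splits)

lemma slack_nest_crossing:
  assumes x: "fpf_involution n x" and c: "crossing n x a b"
  shows "slack n (nest_crossing x a b) t j \<longleftrightarrow> slack n x t j"
  using nests_nest_crossing[OF c x, of 1 j] crossingD(4)[OF c x] by (simp add: slack_def)

text \<open>Turns slack just before a closer into a closable pair whose first strand opens no later.
  The earliest opener with such slack serves as first strand, and a count of openers produces a
  strand crossing it.\<close>

lemma closable_if_slack_closer:
  assumes x: "fpf_involution n x" and b: "below n x (Some y)"
    and a: "a \<in> {1..2*n}" "a < x a" "slack n x (Some y) (x a - 1)"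
  shows "\<exists>a'\<le>a. \<exists>b. closable n x (Some y) a' b"
proof -
  have y: "fpf_involution n y" and le: "nest_le n x y" using b by (auto simp: below_def)
  let ?S = "slack n x (Some y)"
  have S: "?S j \<longleftrightarrow> nests n x 1 j < nests n y 1 j" for j by (simp add: slack_def)
  define good where "good = (\<lambda>a. a \<in> {1..2*n} \<and> a < x a \<and> ?S (x a - 1))"
  define a' where "a' = (LEAST a. good a)"
  have ga: "good a" using a by (simp add: good_def)
  have good: "good a'" unfolding a'_def using ga by (rule LeastI)
  have "a' \<le> a" unfolding a'_def using ga by (rule Least_le)
  have least: "\<not> ?S (x u - 1)" if "1 \<le> u" "u < a'" "u < x u" for u
  proof -
    have "\<not> good u" using that(2) unfolding a'_def by (rule not_less_Least)
    then show ?thesis using that good by (simp add: good_def)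
  qed
  define c where "c = x a'"
  have a': "1 \<le> a'" "a' \<le> 2*n" "a' < c" "?S (c - 1)" "c \<in> {1..2*n}" "x c = a'"
    using good fpf_involutionD[OF x, of a'] by (auto simp: good_def c_def)
  \<comment> \<open>No opener before \<open>a'\<close> has slack just before its closer, so
    \<open>slack_rows\<close> with \<open>i = a' - 1\<close> bounds the prefix surplus by the
    surplus among chords opening at \<open>a'\<close> or later. At \<open>j = a'\<close> this leaves
    none.\<close>
  have rows: "nests n y 1 j - nests n x 1 j \<le> nests n y a' j - nests n x a' j" for j
    using slack_rows[OF x y le, of "a' - 1" j] least a' unfolding S by (auto simp: not_less)
  have "\<not> ?S a'" using rows[of a'] nests_zero[of a' a'] by (simp add: S)
  txt \<open>In \<open>x\<close> more chords open between the last slack-free position \<open>e\<close> and \<open>c\<close> and close after \<open>c\<close>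
    than in \<open>y\<close>; any of them crosses \<open>{a', c}\<close>.\<close>
  define e where "e = Max {j. j < c \<and> \<not> ?S j}"
  have fin: "finite {j. j < c \<and> \<not> ?S j}" by simp
  have "e \<in> {j. j < c \<and> \<not> ?S j}" unfolding e_def
    by (rule Max_in[OF fin]) (use a' \<open>\<not> ?S a'\<close> in blast)
  moreover have "a' \<le> e" unfolding e_def
    by (rule Max_ge[OF fin]) (use a' \<open>\<not> ?S a'\<close> in blast)
  moreover have emax: "?S j" if "e < j" "j < c" for j
    using Max_ge[OF fin, of j] that unfolding e_def by fastforce
  ultimately have e: "e < c" "\<not> ?S e" "a' \<le> e" by auto
  have "e \<noteq> c - 1" using e a' by auto
  let ?R = "\<lambda>f. chords n f (\<lambda>u v. e < u \<and> u < c \<and> c \<le> v)"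
  have c1: "c - 1 \<le> 2*n" and e1: "e \<le> 2*n" using a'(5) e(1) by auto
  \<comment> \<open>Openers strictly between \<open>e\<close> and \<open>c\<close> are the
    difference of two prefix counts; removing those that close before \<open>c\<close> leaves
    \<open>?R f\<close>. From \<open>x\<close> to \<open>y\<close> the count at \<open>c - 1\<close>
    grows strictly while the count at \<open>e\<close> is fixed, so \<open>?R\<close> drops.\<close>
  have R: "?R f = int (c - 1) - nests n f 1 (c - 1) - (int e - nests n f 1 e) - nests n f (Suc e) (c - 1)"
    if f: "fpf_involution n f" for f
  proof -
    let ?op = "chords n f (\<lambda>u v. e < u \<and> u < c)"
    have "chords n f (\<lambda>u v. u \<le> c - 1) = chords n f (\<lambda>u v. u \<le> e) + ?op"
      by (rule chords_split) (use e in auto)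
    moreover have "?op = ?R f + nests n f (Suc e) (c - 1)"
      by (rule chords_split) auto
    ultimately show ?thesis
      using openers_plus_closers[OF f c1] openers_plus_closers[OF f e1] by linarith
  qed
  have "nests n x (Suc e) (c - 1) \<le> nests n y (Suc e) (c - 1)" using le by (simp add: nest_le_def)
  moreover have "nests n x 1 e \<le> nests n y 1 e" using le by (simp add: nest_le_def)
  ultimately have "?R y < ?R x" using R[OF x] R[OF y] a'(4) e(2) unfolding S by linarith
  moreover have "0 \<le> ?R y" unfolding chords_def by (rule sum_nonneg) simp
  ultimately have "0 < ?R x" by linarith
  then obtain u where u: "u \<in> {1..2*n}" "u < x u" "e < u" "u < c" "c \<le> x u"
    unfolding chords_pos_iff by blast
  have "x u \<noteq> c" using u(3) e(3) a'(6) fpf_involutionD(3)[OF x u(1)] by auto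
  then have "crossing n x a' u" using u e a' by (auto simp: crossing_def c_def)
  then have "closable n x (Some y) a' u" using emax u by (auto simp: closable_def c_def)
  then show ?thesis using \<open>a' \<le> a\<close> by blast
qed

lemma slack_closer_ge:
  assumes x: "fpf_involution n x" and b: "below n x (Some y)"
    and min: "\<forall>a' b'. closable n x (Some y) a' b' \<longrightarrow> a \<le> a'"
    and u: "u \<in> {1..2*n}" "u < x u" "slack n x (Some y) (x u - 1)"
  shows "a \<le> u"
  using closable_if_slack_closer[OF x b u] min by (meson order_trans)

text \<open>Minimality of \<open>a\<close> rules out third strands leaving to the left and
  maximality of \<open>x b\<close> those leaving to the right, so exactly one crossing is lost. The
  same choices give room in both rectangles of \<open>nests_close_crossing\<close>.\<close>

lemma closable_best_Some:
  assumes x: "fpf_involution n x" and bel: "below n x (Some y)" and c: "closable n x (Some y) a b"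
    and min: "\<forall>a' b'. closable n x (Some y) a' b' \<longrightarrow> a \<le> a'"
    and max: "\<forall>b'. closable n x (Some y) a b' \<longrightarrow> x b' \<le> x b"
  shows "closing n x a b \<and> below n (close_crossing x a b) (Some y)"
proof -
  have y: "fpf_involution n y" and le: "nest_le n x y" using bel by (auto simp: below_def)
  let ?S = "slack n x (Some y)"
  have S: "?S j \<longleftrightarrow> nests n x 1 j < nests n y 1 j" for j by (simp add: slack_def)
  have cr: "crossing n x a b" and cS: "\<And>j. b \<le> j \<Longrightarrow> j < x a \<Longrightarrow> ?S j" using c by (auto simp: closable_def)
  note D = crossingD[OF cr x]
  have small: "\<not> ?S (x u - 1)" if "1 \<le> u" "u < a" "u < x u" for u
  proof
    assume "?S (x u - 1)"
    moreover have "u \<in> {1..2*n}" using that D(4) by simp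
    ultimately have "a \<le> u" using slack_closer_ge[OF x bel min] that(3) by simp
    then show False using that(2) by simp
  qed
  have rows: "nests n y 1 j - nests n x 1 j \<le> nests n y i j - nests n x i j" if "1 \<le> i" "i \<le> a" for i j
    using slack_rows[OF x y le, of "i - 1" j] small that D(4) unfolding S by (auto simp: not_less)
  have "closing n x a b"
    unfolding closing_def
  proof (intro conjI ballI impI cr)
    fix p assume p: "p \<in> {1..2*n}" "b < p" "p < x a"
    note P = fpf_involutionD[OF x p(1)]
    show "a \<le> x p"
    proof (rule ccontr)
      assume "\<not> a \<le> x p"
      then have "\<not> ?S (x (x p) - 1)" using P p D(1) by (intro small) auto
      moreover have "?S (p - 1)" using p by (intro cS) auto
      ultimately show False using P by simp
    qed
    show "x p \<le> x b"
    proof (rule ccontr)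
      assume n: "\<not> x p \<le> x b"
      then have "crossing n x a p" using p D by (auto simp: crossing_def)
      then have "closable n x (Some y) a p" using cS p by (auto simp: closable_def)
      then show False using max n by blast
    qed
  qed
  moreover have "nests n (close_crossing x a b) i j \<le> nests n y i j" for i j
  proof -
    have "\<not> ?S a" using rows[of a a] nests_zero[of a a] D(4) by (auto simp: S)
    \<comment> \<open>First rectangle: by minimality of \<open>a\<close>, prefix slack at
      \<open>j\<close> carries over to every row \<open>i \<le> a\<close>. Row \<open>0\<close>
      equals row \<open>1\<close>, as the points start at \<open>1\<close>.\<close>
    have r1: "nests n x i j < nests n y i j" if "i \<le> a" "b \<le> j" "j < x a"
    proof (cases "i = 0")
      case True
      have "nests n f 0 j = nests n f 1 j" for f by (rule chords_cong) auto
      then show ?thesis using cS[of j] that True S by auto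
    next
      case False
      then show ?thesis using rows[of i j] that cS[of j] S by auto
    qed
    \<comment> \<open>Second rectangle: \<open>e\<close> is the last position before
      \<open>x a\<close> without slack. By maximality of \<open>x b\<close>, no strand of
      \<open>x\<close> opens between \<open>e\<close> and \<open>i\<close> and closes after
      \<open>j\<close>. Comparing the chords that pass beyond \<open>j\<close> then turns the
      surplus of the suffix from \<open>i\<close> into one for \<open>(i, j)\<close>.\<close>
    have r2: "nests n x i j < nests n y i j" if ij: "b < i" "i \<le> x a" "x b \<le> j"
    proof -
      define e where "e = Max {j. j < x a \<and> \<not> ?S j}"
      have fin: "finite {j. j < x a \<and> \<not> ?S j}" by simp
      have "e \<in> {j. j < x a \<and> \<not> ?S j}" unfolding e_def
        by (rule Max_in[OF fin]) (use D \<open>\<not> ?S a\<close> in \<open>auto intro: less_trans\<close>)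
      moreover have "a \<le> e" unfolding e_def
        by (rule Max_ge[OF fin]) (use D \<open>\<not> ?S a\<close> in \<open>auto intro: less_trans\<close>)
      moreover have emax: "?S j" if "e < j" "j < x a" for j
        using Max_ge[OF fin, of j] that unfolding e_def by fastforce
      ultimately have e: "e < x a" "\<not> ?S e" "a \<le> e" by auto
      have "e < b" using cS[of e] e by (meson not_less)
      let ?T = "\<lambda>f i. chords n f (\<lambda>u v. i \<le> u \<and> j < v)"
      have T: "nests n f i (2*n) = nests n f i j + ?T f i" if f: "fpf_involution n f" for f i
        by (rule chords_split) (use fpf_involutionD(1)[OF f] in auto)
      have "?T x i = ?T x (Suc e)"
      proof (rule chords_cong)
        fix u assume u: "u \<in> {1..2*n}" "u < x u"
        have "i \<le> u" if "e < u" "j < x u"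
        proof (rule ccontr)
          assume "\<not> i \<le> u"
          then have "crossing n x a u" using u that e ij D by (auto simp: crossing_def)
          then have "closable n x (Some y) a u" using emax that by (auto simp: closable_def)
          then have "x u \<le> x b" using max by blast
          then show False using that ij by simp
        qed
        then show "i \<le> u \<and> j < x u \<longleftrightarrow> Suc e \<le> u \<and> j < x u" using \<open>e < b\<close> ij by auto
      qed
      moreover have "?T y i \<le> ?T y (Suc e)" by (rule chords_mono) (use \<open>e < b\<close> ij in auto)
      moreover have "nests n x (Suc e) j \<le> nests n y (Suc e) j" using le by (simp add: nest_le_def)
      moreover have "nests n x (Suc e) (2*n) \<ge> nests n y (Suc e) (2*n)"
      proof -
        have e2: "e \<le> 2*n" using e(1) D(6) by simp
        show ?thesis using nests_suffix[OF x e2] nests_suffix[OF y e2] e(2) unfolding S by linarith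
      qed
      moreover have "nests n x i (2*n) < nests n y i (2*n)"
      proof -
        have i2: "i - 1 \<le> 2*n" and i1: "Suc (i - 1) = i" using ij D(6) by simp_all
        have "?S (i - 1)" using ij by (intro cS) auto
        then show ?thesis using nests_suffix[OF x i2] nests_suffix[OF y i2] unfolding i1 S by linarith
      qed
      ultimately show ?thesis using T[OF x, of i] T[OF y, of i] T[OF x, of "Suc e"] T[OF y, of "Suc e"]
        by linarith
    qed
    have "nests n x i j \<le> nests n y i j" using le by (simp add: nest_le_def)
    \<comment> \<open>The rectangles are disjoint (\<open>i \<le> a\<close> against
      \<open>b < i\<close>), so a surplus of one suffices.\<close>
    then have "nests n x i j + (of_bool P + of_bool Q) \<le> nests n y i j"
      if "P \<Longrightarrow> nests n x i j < nests n y i j" "Q \<Longrightarrow> nests n x i j < nests n y i j" "\<not> (P \<and> Q)" for P Q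
      using that by (cases P; cases Q) simp_all
    from this[of "i \<le> a \<and> b \<le> j \<and> j < x a" "b < i \<and> i \<le> x a \<and> x b \<le> j"] show ?thesis
      using r1 r2 D(1) unfolding nests_close_crossing[OF cr x] by (simp add: add.assoc)
  qed
  ultimately show ?thesis using y by (simp add: below_def nest_le_def)
qed

text \<open>With no target every crossing is closable. A third strand leaving to the left would give
  a crossing with a smaller first opener, one leaving to the right a crossing at \<open>a\<close>
  with a larger closer.\<close>

lemma closable_best_None:
  assumes x: "fpf_involution n x" and c: "closable n x None a b"
    and min: "\<forall>a' b'. closable n x None a' b' \<longrightarrow> a \<le> a'"
    and max: "\<forall>b'. closable n x None a b' \<longrightarrow> x b' \<le> x b"
  shows "closing n x a b"
proof -
  have cl: "closable n x None a b \<longleftrightarrow> crossing n x a b" for a b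
    by (simp add: closable_def slack_def)
  have cr: "crossing n x a b" using c by (simp add: cl)
  note D = crossingD[OF cr x]
  show ?thesis
    unfolding closing_def
  proof (intro conjI ballI impI cr)
    fix p assume p: "p \<in> {1..2*n}" "b < p" "p < x a"
    note P = fpf_involutionD[OF x p(1)]
    show "a \<le> x p"
    proof (rule ccontr)
      assume "\<not> a \<le> x p"
      moreover from this have "crossing n x (x p) a" using P p D by (auto simp: crossing_def)
      ultimately show False using min unfolding cl by blast
    qed
    show "x p \<le> x b"
    proof (rule ccontr)
      assume n: "\<not> x p \<le> x b"
      then have "crossing n x a p" using p D by (auto simp: crossing_def)
      then show False using max n unfolding cl by blast
    qed
  qed
qed

lemma closable_best:
  assumes x: "fpf_involution n x" and bel: "below n x t" and c: "closable n x t a b"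
    and min: "\<forall>a' b'. closable n x t a' b' \<longrightarrow> a \<le> a'"
    and max: "\<forall>b'. closable n x t a b' \<longrightarrow> x b' \<le> x b"
  shows "closing n x a b \<and> below n (close_crossing x a b) t"
proof (cases t)
  case None
  then show ?thesis using closable_best_None[OF x, of a b] c min max by (auto simp: below_def)
next
  case (Some y)
  then show ?thesis using closable_best_Some[OF x, of y a b] bel c min max by blast
qed

text \<open>No opener of \<open>x\<close> can have slack just before its closer, so
  \<open>slack_rows\<close> with \<open>i = j - 1\<close> bounds the surplus at \<open>j\<close> by
  that of the one-point row \<open>{j}\<close>, which holds no chord.\<close>

lemma eq_nests_if_not_closable:
  assumes x: "fpf_involution n x" and bel: "below n x (Some y)" and j: "j \<le> 2 * n"
    and none: "\<forall>a b. \<not> closable n x (Some y) a b"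
  shows "nests n y 1 j = nests n x 1 j"
proof (cases "j = 0")
  case True
  then show ?thesis using nests_zero[of j 1] by simp
next
  case False
  have y: "fpf_involution n y" and le: "nest_le n x y" using bel by (auto simp: below_def)
  have "nests n y 1 j - nests n x 1 j \<le> nests n y (Suc (j - 1)) j - nests n x (Suc (j - 1)) j"
  proof (rule slack_rows[OF x y le])
    fix a assume a: "1 \<le> a" "a \<le> j - 1" "a < x a"
    then have "a \<in> {1..2*n}" using j by simp
    then have "\<not> slack n x (Some y) (x a - 1)"
      using closable_if_slack_closer[OF x bel _ a(3)] none by blast
    then show "nests n y 1 (x a - 1) \<le> nests n x 1 (x a - 1)" by (simp add: slack_def)
  qed (use j in simp)
  moreover have "nests n f (Suc (j - 1)) j = 0" for f using False by (intro nests_zero) simp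
  moreover have "nests n x 1 j \<le> nests n y 1 j" using le by (simp add: nest_le_def)
  ultimately show ?thesis by simp
qed

text \<open>The lexicographic codes of \<open>(a, -d)\<close> and \<open>(a, b)\<close>.\<close>

definition close_label :: "nat \<Rightarrow> nat \<Rightarrow> nat \<Rightarrow> nat" where
  "close_label n a d = a * (2 * n + 1) + (2 * n - d)"

text \<open>The code of the pair \<open>(2 * n + 1, 0)\<close>, hence above every closing label,
  because openers are at most \<open>2 * n\<close>.\<close>

definition top_label :: "nat \<Rightarrow> nat" where
  "top_label n = (2 * n + 1) * (2 * n + 1)"

definition nest_label :: "nat \<Rightarrow> nat \<Rightarrow> nat \<Rightarrow> nat" where
  "nest_label n a b = top_label n + 1 + (a * (2 * n + 1) + b)"

lemma lex_code_less:
  fixes a b a' b' m :: nat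
  assumes "b < m" "b' < m"
  shows "a * m + b < a' * m + b' \<longleftrightarrow> a < a' \<or> a = a' \<and> b < b'"
proof -
  have less: "u * m + v < u' * m + v'" if "u < u'" "v < m" for u u' v v' :: nat
  proof -
    have "u * m + v < Suc u * m" using that by simp
    also have "\<dots> \<le> u' * m" using that by (intro mult_le_mono1) simp
    finally show ?thesis by simp
  qed
  show ?thesis using less[of a a' b b'] less[of a' a b' b] assms by (cases a a' rule: linorder_cases) auto
qed

lemma close_label_less:
  assumes "1 \<le> d" "1 \<le> d'" "d \<le> 2 * n" "d' \<le> 2 * n"
  shows "close_label n a d < close_label n a' d' \<longleftrightarrow> a < a' \<or> a = a' \<and> d' < d"
  unfolding close_label_def using assms by (subst lex_code_less) auto

lemma nest_label_less:
  assumes "b \<le> 2 * n" "b' \<le> 2 * n"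
  shows "nest_label n a b < nest_label n a' b' \<longleftrightarrow> a < a' \<or> a = a' \<and> b < b'"
  unfolding nest_label_def using lex_code_less[of b "2 * n + 1" b' a a'] assms by simp

lemma close_label_less_top: "a \<le> 2 * n \<Longrightarrow> close_label n a d < top_label n"
  using lex_code_less[of "2 * n - d" "2 * n + 1" 0 a "2 * n + 1"]
  by (simp add: close_label_def top_label_def)

lemma top_less_nest_label: "top_label n < nest_label n a b"
  by (simp add: nest_label_def)

section \<open>Labelled steps and their order\<close>

definition step :: "nat \<Rightarrow> (nat \<Rightarrow> nat) \<Rightarrow> nat \<Rightarrow> (nat \<Rightarrow> nat) \<Rightarrow> bool" where
  "step n f l g \<longleftrightarrow>
     (\<exists>a b. closing n f a b \<and> g = close_crossing f a b \<and> l = close_label n a (f b)) \<or>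
     (\<exists>a b. nesting n f a b \<and> g = nest_crossing f a b \<and> l = nest_label n a b)"

lemma stepE:
  assumes "step n f l g"
  obtains (close) a b where "closing n f a b" "g = close_crossing f a b" "l = close_label n a (f b)"
    | (nest) a b where "nesting n f a b" "g = nest_crossing f a b" "l = nest_label n a b"
  using assms unfolding step_def by blast

text \<open>Least first opener, then greatest closer: this extreme pair is the one with the least
  closing label.\<close>

lemma step_closable:
  assumes x: "fpf_involution n x" and bel: "below n x t" and c: "closable n x t a b"
  obtains a' b' where "closable n x t a' b'" "closing n x a' b'"
    "below n (close_crossing x a' b') t" "\<forall>u v. closable n x t u v \<longrightarrow> a' \<le> u"
    "\<forall>v. closable n x t a' v \<longrightarrow> x v \<le> x b'"
proof -
  define a' where "a' = (LEAST a. \<exists>b. closable n x t a b)"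
  have ex: "\<exists>b. closable n x t a' b" unfolding a'_def by (rule LeastI_ex) (use c in blast)
  have min: "\<forall>u v. closable n x t u v \<longrightarrow> a' \<le> u"
    unfolding a'_def by (blast intro: Least_le)
  let ?V = "{x v |v. closable n x t a' v}"
  have "?V \<subseteq> x ` {1..2*n}" by (auto simp: closable_def crossing_def)
  then have fin: "finite ?V" by (rule finite_subset) simp
  have "?V \<noteq> {}" using ex by blast
  then have "Max ?V \<in> ?V" using fin by (rule Max_in[rotated])
  then obtain b' where b': "closable n x t a' b'" "x b' = Max ?V" by auto
  have max: "\<forall>v. closable n x t a' v \<longrightarrow> x v \<le> x b'"
    unfolding b'(2) using Max_ge[OF fin] by blast
  show ?thesis using that[OF b'(1)] closable_best[OF x bel b'(1) min max] min max by blast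
qed

text \<open>A closable pair need not be a step itself, but the extreme pair is one and its label is
  no larger. This supplies the follow-up labels required after a first step that is not the best
  one.\<close>

lemma step_le_close_label:
  assumes x: "fpf_involution n x" and bel: "below n x t" and c: "closable n x t a b"
  shows "\<exists>w l. step n x l w \<and> below n w t \<and> l \<le> close_label n a (x b)"
proof -
  obtain a' b' where ab: "closable n x t a' b'" "closing n x a' b'"
    "below n (close_crossing x a' b') t" "\<forall>u v. closable n x t u v \<longrightarrow> a' \<le> u"
    "\<forall>v. closable n x t a' v \<longrightarrow> x v \<le> x b'"
    using step_closable[OF x bel c] .
  have xb: "1 \<le> x b" "x b \<le> 2*n" "1 \<le> x b'" "x b' \<le> 2*n"
    using crossingD(7)[OF _ x, of a b] crossingD(7)[OF _ x, of a' b'] c ab(1) by (auto simp: closable_def)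
  have "a' \<le> a" "a' = a \<Longrightarrow> x b \<le> x b'" using ab c by blast+
  then have "\<not> close_label n a (x b) < close_label n a' (x b')"
    using close_label_less[OF xb(1,3,2,4), of a a'] by auto
  moreover have "step n x (close_label n a' (x b')) (close_crossing x a' b')"
    using ab(2) by (auto simp: step_def)
  ultimately show ?thesis using ab(3) by (meson not_less)
qed

text \<open>The closing condition keeps \<open>x a\<close> out of the gap between \<open>b'\<close>
  and \<open>x a'\<close>. If the strand at \<open>b\<close> is altered, the strand at
  \<open>a\<close> therefore still crosses one of the two new strands.\<close>

lemma crossing_close_crossing_persists:
  assumes x: "fpf_involution n x" and ab: "crossing n x a b" and c: "closing n x a' b'" and "a < a'"
  shows "\<exists>v. crossing n (close_crossing x a' b') a v"
proof -
  have cr: "crossing n x a' b'" using c by (simp add: closing_def)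
  note D = crossingD[OF ab x] and D' = crossingD[OF cr x]
  note g = close_crossing_simps[OF cr]
  let ?z = "close_crossing x a' b'"
  have inj: "x u = x v \<Longrightarrow> u = v" if "u \<in> {1..2*n}" "v \<in> {1..2*n}" for u v
    using fpf_involutionD(3)[OF x] that by metis
  have za: "?z a = x a" using D' \<open>a < a'\<close> by (intro crossing_update_other) auto
  have out: "\<not> (b' < x a \<and> x a < x a')"
    using c D(6,8) \<open>a < a'\<close> unfolding closing_def by (metis not_less)
  have ne: "x a \<noteq> x a'" using inj[OF D(4) D'(4)] \<open>a < a'\<close> by blast
  consider "b = b'" | "b = a'" | "b \<noteq> a'" "b \<noteq> b'" by blast
  then show ?thesis
  proof cases
    case 1
    then have "x a' < x a" using D(2) out ne by linarith
    then have "crossing n ?z a (x a')"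
      using D D' 1 \<open>a < a'\<close> za g by (simp add: crossing_def)
    then show ?thesis by blast
  next
    case 2
    have "x a \<noteq> b'" using D'(1,2,3) D(8) \<open>a < a'\<close> by auto
    moreover have "x a < x a'" using D(3) 2 by simp
    ultimately have "x a < b'" using out by linarith
    then have "crossing n ?z a a'"
      using D D' 2 za g by (simp add: crossing_def)
    then show ?thesis by blast
  next
    case 3
    have "b \<noteq> x a'" "b \<noteq> x b'" using D(1-3) D' \<open>a < a'\<close> by auto
    then have "?z b = x b" using 3 by (intro crossing_update_other) auto
    then have "crossing n ?z a b" using D za by (simp add: crossing_def)
    then show ?thesis by blast
  qed
qed

text \<open>A first step at a later opener does not use up the room needed at \<open>a\<close>, so a
  smaller closing label is still available after it.\<close>

lemma closable_persists:
  assumes x: "fpf_involution n x" and ab: "closable n x t a b" and c: "closing n x a' b'" and "a < a'"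
    and bel: "below n (close_crossing x a' b') t"
  shows "\<exists>u\<le>a. \<exists>v. closable n (close_crossing x a' b') t u v"
proof -
  have crab: "crossing n x a b" using ab by (simp add: closable_def)
  have cr: "crossing n x a' b'" using c by (simp add: closing_def)
  note D = crossingD[OF crab x] and D' = crossingD[OF cr x]
  let ?z = "close_crossing x a' b'"
  have z: "fpf_involution n ?z" using fpf_involution_close_crossing[OF cr x] .
  have za: "?z a = x a" using D' \<open>a < a'\<close> by (intro crossing_update_other) auto
  show ?thesis
  proof (cases t)
    case None
    then show ?thesis
      using crossing_close_crossing_persists[OF x crab c \<open>a < a'\<close>] by (auto simp: closable_def slack_def)
  next
    case (Some y)
    have out: "\<not> (b' < x a \<and> x a < x a')"
      using c D(6,8) \<open>a < a'\<close> unfolding closing_def by (metis not_less)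
    have "x a \<noteq> b'" using D'(1,2,3) D(8) \<open>a < a'\<close> by auto
    \<comment> \<open>\<open>x a\<close> is neither in the gap between \<open>b'\<close> and
      \<open>x a'\<close> nor an end of it, so \<open>x a - 1\<close> lies outside
      \<open>{b'..<x a'}\<close>, the only positions where the step consumes slack.\<close>
    then have "x a - 1 < b' \<or> x a' \<le> x a - 1"
      using out D(1,2) fpf_involutionD(3)[OF x D(4)] fpf_involutionD(3)[OF x D'(4)] \<open>a < a'\<close>
      by (cases "x a = x a'") auto
    moreover have "slack n x t (x a - 1)" using ab D(2) by (auto simp: closable_def)
    ultimately have "slack n ?z (Some y) (?z a - 1)"
      using slack_close_crossing(2)[OF x cr] za Some by simp
    then show ?thesis
      using closable_if_slack_closer[OF z _ D(4)] bel za D(1,2) unfolding Some by simp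
  qed
qed

text \<open>The local condition of \<open>lex_first_ascending_exists\<close>, with the extreme
  closing step as \<open>z\<close>. The edge to the adjoined element is not a \<open>step\<close>,
  so for \<open>t = None\<close> a matching \<open>w\<close> without crossings forms an alternative
  of its own, with follow-up label \<open>top_label n\<close>.\<close>

lemma EL_closable:
  assumes x: "fpf_involution n x" and bel: "below n x t" and ex: "closable n x t a0 b0"
  shows "\<exists>z l. step n x l z \<and> below n z t \<and> l < top_label n \<and>
    (\<forall>w m. step n x m w \<and> below n w t \<and> w \<noteq> z \<longrightarrow> l < m \<and>
      (t = None \<and> (\<forall>u v. \<not> crossing n w u v) \<and> top_label n \<le> m \<or>
       (\<exists>v k. step n w k v \<and> below n v t \<and> k \<le> m))) \<and>
    (\<forall>v k. step n z k v \<and> below n v t \<longrightarrow> l < k)"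
proof -
  obtain a b where ab: "closable n x t a b" "closing n x a b"
    "below n (close_crossing x a b) t" and min: "\<forall>u v. closable n x t u v \<longrightarrow> a \<le> u"
    and max: "\<forall>v. closable n x t a v \<longrightarrow> x v \<le> x b"
    using step_closable[OF x bel ex] .
  have cr: "crossing n x a b" using ab by (simp add: closable_def)
  note D = crossingD[OF cr x]
  define z where "z = close_crossing x a b"
  define l where "l = close_label n a (x b)"
  have z: "fpf_involution n z" unfolding z_def using fpf_involution_close_crossing[OF cr x] .
  have l: "l < top_label n" unfolding l_def by (rule close_label_less_top) (use D in simp)
  have inj: "x u = x v \<Longrightarrow> u = v" if "u \<in> {1..2*n}" "v \<in> {1..2*n}" for u v
    using fpf_involutionD(3)[OF x] that by metis
  have other: "l < m \<and> (t = None \<and> (\<forall>u v. \<not> crossing n w u v) \<and> top_label n \<le> m \<or>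
       (\<exists>v k. step n w k v \<and> below n v t \<and> k \<le> m))"
    if w: "step n x m w" "below n w t" "w \<noteq> z" for w m
    using w(1)
  proof (cases rule: stepE)
    case (close a' b')
    note c = close(1) and weq = close(2) and m = close(3)
    have cl: "closable n x t a' b'" using closing_closable[OF x c] w(2) weq by simp
    have cr': "crossing n x a' b'" using c by (simp add: closing_def)
    note D' = crossingD[OF cr' x]
    have wf: "fpf_involution n w" unfolding weq using fpf_involution_close_crossing[OF cr' x] .
    have lab: "close_label n u (x v) < m \<longleftrightarrow> u < a' \<or> u = a' \<and> x b' < x v" if "x v \<in> {1..2*n}" for u v
      unfolding m by (rule close_label_less) (use that D' in auto)
    have "a \<le> a'" using min cl by blast
    then consider "a < a'" | "a = a'" by linarith
    then show ?thesis
    proof cases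
      case 1
      obtain u v where uv: "u \<le> a" "closable n w t u v"
        using closable_persists[OF x ab(1) c 1] w(2) unfolding weq by blast
      have wv: "w v \<in> {1..2*n}" using uv(2) crossingD(7)[OF _ wf] by (auto simp: closable_def)
      have "close_label n u (w v) < m" unfolding m
        using close_label_less[of "w v" "x b'" n u a'] wv D'(7) uv(1) 1 by auto
      then have "\<exists>v k. step n w k v \<and> below n v t \<and> k \<le> m"
        using step_le_close_label[OF wf w(2) uv(2)] by (meson less_imp_le order_trans)
      moreover have "l < m" unfolding l_def using lab[of b a] D(7) 1 by blast
      ultimately show ?thesis by blast
    next
      case 2
      have "x b' \<le> x b" using max cl 2 by blast
      moreover have "x b' \<noteq> x b" using inj[OF D'(5) D(5)] w(3) 2 unfolding weq z_def by blast
      ultimately have lt: "x b' < x b" by simp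
      \<comment> \<open>Otherwise \<open>{b, x b}\<close> would be a third strand leaving to the
        right, against \<open>closing n x a b'\<close>. With \<open>b < b'\<close> the new strand
        \<open>{a, b'}\<close> still crosses \<open>{b, x b}\<close>, so \<open>(a, b)\<close>
        remains closable in \<open>w\<close>.\<close>
      have "b < b'"
      proof (rule ccontr)
        assume "\<not> b < b'"
        moreover have "b \<noteq> b'" using lt by blast
        ultimately have "b' < b" by simp
        then have "x b \<le> x b'" using c D(2,5) 2 unfolding closing_def by blast
        then show False using lt by simp
      qed
      have g: "w a = b'" unfolding weq using close_crossing_simps(1)[OF cr'] 2 by simp
      have wb: "w b = x b"
        unfolding weq by (rule crossing_update_other) (use D D' 2 lt \<open>b < b'\<close> in auto)
      have "crossing n w a b" using D D' g wb \<open>b < b'\<close> lt 2 by (auto simp: crossing_def)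
      moreover have "slack n w t j" if "b \<le> j" "j < b'" for j
      proof -
        have "slack n x t j" using ab(1) that D'(2) 2 by (auto simp: closable_def)
        then show ?thesis unfolding weq using slack_close_crossing(2)[OF x cr', of j t] that by blast
      qed
      ultimately have "closable n w t a b" using g by (auto simp: closable_def)
      moreover have lm: "close_label n a (x b) < m" using lab[of b a] D(7) 2 lt by blast
      ultimately have "\<exists>v k. step n w k v \<and> below n v t \<and> k \<le> m"
        using step_le_close_label[OF wf w(2), of a b] wb by (metis less_imp_le order_trans)
      then show ?thesis using lm unfolding l_def by blast
    qed
  next
    case (nest a' b')
    note c = nest(1) and weq = nest(2) and m = nest(3)
    have cr': "crossing n x a' b'" using c by (simp add: nesting_def)
    have wf: "fpf_involution n w" unfolding weq using fpf_involution_nest_crossing[OF cr' x] .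
    have lm: "top_label n \<le> m" unfolding m using top_less_nest_label[of n a' b'] by simp
    \<comment> \<open>For a proper target, nesting leaves prefix counts alone, so the slack at
      \<open>b\<close> survives and some pair of \<open>w\<close> is closable.\<close>
    have "t = None \<and> (\<forall>u v. \<not> crossing n w u v) \<or> (\<exists>u v. closable n w t u v)"
    proof (cases t)
      case None
      then show ?thesis by (auto simp: closable_def slack_def)
    next
      case (Some y)
      have "slack n w t b" unfolding weq slack_nest_crossing[OF x cr']
        using ab(1) D by (auto simp: closable_def)
      then have "\<not> nests n y 1 b = nests n w 1 b" using Some by (simp add: slack_def)
      moreover have "b \<le> 2*n" using D(5) by simp
      ultimately show ?thesis using eq_nests_if_not_closable[OF wf] w(2) unfolding Some by blast
    qed
    moreover have "\<exists>v k. step n w k v \<and> below n v t \<and> k \<le> m" if uv: "closable n w t u v" for u v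
    proof -
      have "u \<le> 2*n" using uv by (auto simp: closable_def crossing_def)
      then have "close_label n u (w v) \<le> m" using close_label_less_top[of u n "w v"] lm by simp
      then show ?thesis using step_le_close_label[OF wf w(2) uv] by (meson order_trans)
    qed
    ultimately show ?thesis using l lm by (meson less_le_trans)
  qed
  have asc: "l < k" if v: "step n z k v" "below n v t" for v k
    using v(1)
  proof (cases rule: stepE)
    case (nest a' b')
    note k = nest(3)
    show ?thesis using l top_less_nest_label[of n a' b'] unfolding k by simp
  next
    case (close a' b')
    note c = close(1) and veq = close(2) and k = close(3)
    have cl: "closable n z t a' b'" using closing_closable[OF z c] v(2) veq by simp
    then have cr': "crossing n z a' b'" and sl: "\<And>j. b' \<le> j \<Longrightarrow> j < z a' \<Longrightarrow> slack n z t j"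
      by (auto simp: closable_def)
    note D' = crossingD[OF cr' z]
    note g = close_crossing_simps[OF cr, folded z_def]
    note other = crossing_update_other(1)[of _ a b x, folded z_def]
    have slx: "slack n x t j" if "slack n z t j" for j
      using slack_close_crossing(1)[OF x cr] that unfolding z_def .
    have lab: "l < k \<longleftrightarrow> a < a' \<or> a = a' \<and> z b' < x b"
      unfolding l_def k by (rule close_label_less) (use D D' in auto)
    \<comment> \<open>An opener \<open>a' < a\<close> keeps its partner, and its new pair would
      already show in \<open>x\<close>: with a target through slack just before its closer, without
      one through a crossing found in each position of \<open>b'\<close>.\<close>
    have "a \<le> a'"
    proof (rule ccontr)
      assume "\<not> a \<le> a'"
      then have za: "z a' = x a'" using D by (intro other) auto
      show False
      proof (cases t)
        case (Some y)
        have "slack n z t (z a' - 1)" using D'(2) by (intro sl) auto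
        then have "slack n x (Some y) (x a' - 1)" using slx za Some by simp
        moreover have "a' < x a'" using D'(1,2) za by simp
        ultimately have "a \<le> a'"
          using slack_closer_ge[OF x, of y a a'] bel min D'(4) unfolding Some by blast
        then show False using \<open>\<not> a \<le> a'\<close> by simp
      next
        case None
        have nc: "\<not> crossing n x a' u" for u
          using min None \<open>\<not> a \<le> a'\<close> by (auto simp: closable_def slack_def)
        consider "b' = a" | "b' = b" | "b' = x a" | "b' = x b" | "b' \<notin> {a, b, x a, x b}" by blast
        then show False
        proof cases
          case 1
          then have "crossing n x a' a" using D D' za g by (auto simp: crossing_def)
          then show False using nc by blast
        next
          case 2
          then show False using D D' g \<open>\<not> a \<le> a'\<close> by simp
        next
          case 3
          then have "crossing n x a' b"
            using D D' za g \<open>\<not> a \<le> a'\<close> by (auto simp: crossing_def)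
          then show False using nc by blast
        next
          case 4
          then show False using D D' g za by simp
        next
          case 5
          then have "crossing n x a' b'" using D' za other[of b'] by (auto simp: crossing_def)
          then show False using nc by blast
        qed
      qed
    qed
    \<comment> \<open>Otherwise \<open>(a, b')\<close> would be closable in \<open>x\<close>, with
      slack inherited from \<open>z\<close> before \<open>b\<close> and from the choice of
      \<open>(a, b)\<close> from \<open>b\<close> on. Maximality of \<open>x b\<close> would then
      force \<open>b' = b\<close>.\<close>
    moreover have "z b' < x b" if "a' = a"
    proof -
      have b': "a < b'" "b' < b" "b < z b'" using D' g that by auto
      have zb: "z b' = x b'" using b' D by (intro other) auto
      show ?thesis
      proof (rule ccontr)
        assume "\<not> z b' < x b"
        then have "crossing n x a b'" using D D'(5) b' zb by (auto simp: crossing_def)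
        moreover have "slack n x t j" if "b' \<le> j" "j < x a" for j
        proof (cases "j < b")
          case True
          then show ?thesis using slx sl[of j] that g \<open>a' = a\<close> by simp
        next
          case False
          then show ?thesis using ab(1) that by (auto simp: closable_def)
        qed
        ultimately have "closable n x t a b'" by (auto simp: closable_def)
        then have "x b' \<le> x b" using max by blast
        then have "x b' = x b" using \<open>\<not> z b' < x b\<close> zb by simp
        then have "b' = b" using inj[OF D'(5) D(5)] by blast
        then show False using b' by simp
      qed
    qed
    ultimately show ?thesis unfolding lab by linarith
  qed
  have "step n x l z" unfolding step_def l_def z_def using ab(2) by blast
  then show ?thesis using ab(3) l other asc unfolding z_def by blast
qed

section \<open>Intervals with constant openers\<close>

lemma nests_row:
  assumes "a \<in> {1..2*n}"
  shows "nests n f a j = of_bool (a < f a \<and> f a \<le> j) + nests n f (Suc a) j"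
proof -
  have "nests n f a j = chords n f (\<lambda>u v. u = a \<and> v \<le> j) + nests n f (Suc a) j"
    by (rule chords_split) auto
  moreover have "chords n f (\<lambda>u v. u = a \<and> v \<le> j) = (\<Sum>u\<in>{a}. of_bool (u < f u \<and> u = a \<and> f u \<le> j))"
    unfolding chords_def by (rule sum.mono_neutral_right) (use assms in auto)
  ultimately show ?thesis by simp
qed

definition agree_below :: "nat \<Rightarrow> (nat \<Rightarrow> nat) \<Rightarrow> (nat \<Rightarrow> nat) \<Rightarrow> bool" where
  "agree_below a x y \<longleftrightarrow> (\<forall>u. 1 \<le> u \<longrightarrow> u < a \<longrightarrow> x u = y u)"

text \<open>A prefix count increases at \<open>j\<close> exactly when \<open>j\<close> closes a
  chord, so equal prefix counts mean equal closers and hence equal openers.\<close>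

definition same_closers :: "nat \<Rightarrow> (nat \<Rightarrow> nat) \<Rightarrow> (nat \<Rightarrow> nat) \<Rightarrow> bool" where
  "same_closers n x y \<longleftrightarrow> (\<forall>j\<le>2*n. nests n x 1 j = nests n y 1 j)"

text \<open>Chords opening before \<open>i\<close> are common to \<open>x\<close> and
  \<open>y\<close> and cancel from the equal prefix counts.\<close>

lemma agree_below_nests:
  assumes s: "same_closers n x y" and ag: "agree_below a x y" and "i \<le> a" "j \<le> 2*n"
  shows "nests n x i j = nests n y i j"
proof -
  have "chords n x (\<lambda>u v. u < i \<and> v \<le> j) = chords n y (\<lambda>u v. u < i \<and> v \<le> j)"
    unfolding chords_def by (rule sum.cong) (use ag \<open>i \<le> a\<close> in \<open>auto simp: agree_below_def\<close>)
  moreover have "nests n x 1 j = nests n y 1 j" using s \<open>j \<le> 2*n\<close> by (simp add: same_closers_def)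
  ultimately show ?thesis using nests_split_row[of n x j i] nests_split_row[of n y j i] by linarith
qed

lemma agree_below_nests_Suc:
  assumes s: "same_closers n x y" and ag: "agree_below a x y" and a: "a \<in> {1..2*n}" and j: "j \<le> 2*n"
  shows "nests n y (Suc a) j - nests n x (Suc a) j = of_bool (a < x a \<and> x a \<le> j) - of_bool (a < y a \<and> y a \<le> j)"
  using agree_below_nests[OF s ag order_refl j] nests_row[OF a, of x j] nests_row[OF a, of y j] by linarith

text \<open>Rows up to \<open>a\<close> already agree, so a nesting step at \<open>a' < a\<close>
  finds no room in row \<open>a' + 1\<close>. In row \<open>a + 1\<close> there is room only for
  columns \<open>j\<close> with \<open>x a \<le> j < y a\<close>, which limits the last affected
  column \<open>x b' - 1\<close>.\<close>

lemma nest_crossing_agree_below: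
  assumes x: "fpf_involution n x" and s: "same_closers n x y" and ag: "agree_below a x y"
    and c: "crossing n x a' b'" and le: "nest_le n (nest_crossing x a' b') y"
    and a: "a \<in> {1..2*n}" "a < y a"
  shows "a \<le> a'" "a' = a \<Longrightarrow> x b' \<le> y a"
proof -
  note D = crossingD[OF c x]
  show "a \<le> a'"
  proof (rule ccontr)
    assume "\<not> a \<le> a'"
    moreover have "nests n x (Suc a') (x a') + 1 \<le> nests n y (Suc a') (x a')"
    proof -
      have "nests n x (Suc a') (x a') + 1 = nests n (nest_crossing x a' b') (Suc a') (x a')"
        using D(1,3) nests_nest_crossing[OF c x, of "Suc a'" "x a'"] by simp
      also have "\<dots> \<le> nests n y (Suc a') (x a')" using le unfolding nest_le_def by blast
      finally show ?thesis .
    qed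
    moreover have "x a' \<le> 2*n" using D(6) by simp
    ultimately show False using agree_below_nests[OF s ag, of "Suc a'" "x a'"] by simp
  qed
  assume "a' = a"
  have "nests n x (Suc a) (x b' - 1) + 1 = nests n (nest_crossing x a' b') (Suc a) (x b' - 1)"
    using D(1,3) \<open>a' = a\<close> nests_nest_crossing[OF c x, of "Suc a" "x b' - 1"] by auto
  also have "\<dots> \<le> nests n y (Suc a) (x b' - 1)" using le unfolding nest_le_def by blast
  finally have "nests n x (Suc a) (x b' - 1) + 1 \<le> nests n y (Suc a) (x b' - 1)" .
  moreover have "x b' - 1 \<le> 2*n" using D(7) by (meson atLeastAtMost_iff diff_le_self le_trans)
  ultimately have "of_bool (a < y a \<and> y a \<le> x b' - 1) + 1 \<le> (of_bool (a < x a \<and> x a \<le> x b' - 1) :: int)"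
    using agree_below_nests_Suc[OF s ag a(1), of "x b' - 1"] by linarith
  then have "\<not> y a \<le> x b' - 1" using a(2) by (auto simp: of_bool_def split: if_splits)
  then show "x b' \<le> y a" by simp
qed

text \<open>If \<open>a\<close> closed a chord in one of them, its partner would be an earlier
  point, where both agree, forcing \<open>x a = y a\<close>. So both open at \<open>a\<close>, and
  the counts of row \<open>a + 1\<close> at column \<open>y a\<close> force \<open>x a\<close> to
  come first.\<close>

lemma first_difference:
  assumes x: "fpf_involution n x" and y: "fpf_involution n y" and le: "nest_le n x y"
    and s: "same_closers n x y" and ag: "agree_below a x y" and a: "a \<in> {1..2*n}" "x a \<noteq> y a"
  shows "a < x a" "x a < y a"
proof -
  have up: "a < f a" if f: "fpf_involution n f" and g: "fpf_involution n g" and ag: "agree_below a f g"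
    and ne: "f a \<noteq> g a" for f g
  proof (rule ccontr)
    assume "\<not> a < f a"
    then have "f a < a" using fpf_involutionD(2)[OF f a(1)] by simp
    moreover have "1 \<le> f a" using fpf_involutionD(1)[OF f a(1)] by simp
    ultimately have "f (f a) = g (f a)" using ag by (simp add: agree_below_def)
    then have "g (f a) = a" using fpf_involutionD(3)[OF f a(1)] by simp
    then have "g a = f a" using fpf_involutionD(3)[OF g fpf_involutionD(1)[OF f a(1)]] by simp
    then show False using ne by simp
  qed
  show "a < x a" using up[OF x y ag a(2)] .
  have "a < y a" using up[OF y x _ a(2)[symmetric]] ag by (simp add: agree_below_def)
  have "y a \<le> 2*n" using fpf_involutionD(1)[OF y a(1)] by simp
  moreover have "nests n x (Suc a) (y a) \<le> nests n y (Suc a) (y a)" using le by (simp add: nest_le_def)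
  ultimately have "(of_bool (a < y a \<and> y a \<le> y a) :: int) \<le> of_bool (a < x a \<and> x a \<le> y a)"
    using agree_below_nests_Suc[OF s ag a(1), of "y a"] by linarith
  then show "x a < y a" using \<open>a < y a\<close> a(2) by (auto simp: of_bool_def split: if_splits)
qed

text \<open>The lexicographically first step in a Bruhat interval: \<open>b\<close> is the first
  later point whose partner lies in \<open>{x a<..y a}\<close>. Leastness gives both the nesting
  condition and the room in the rectangle filled by the step.\<close>

lemma first_difference_nesting:
  assumes x: "fpf_involution n x" and y: "fpf_involution n y" and le: "nest_le n x y"
    and s: "same_closers n x y" and ag: "agree_below a x y" and a: "a \<in> {1..2*n}" "x a \<noteq> y a"
  obtains b where "nesting n x a b" "nest_le n (nest_crossing x a b) y" "x b \<le> y a"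
    "\<forall>b'. a < b' \<longrightarrow> x a < x b' \<longrightarrow> x b' \<le> y a \<longrightarrow> b \<le> b'"
proof -
  note fd = first_difference[OF x y le s ag a]
  have xa: "x a \<in> {1..2*n}" "x (x a) = a" using fpf_involutionD[OF x a(1)] by simp_all
  have ya: "y a \<in> {1..2*n}" "y (y a) = a" using fpf_involutionD[OF y a(1)] by simp_all
  have ya2: "y a \<le> 2*n" using ya(1) by simp
  let ?P = "\<lambda>b. a < b \<and> x a < x b \<and> x b \<le> y a"
  \<comment> \<open>A candidate exists: the partner in \<open>x\<close> of the wanted value
    \<open>y a\<close>.\<close>
  have "?P (x (y a))"
  proof -
    have q: "x (y a) \<in> {1..2*n}" "x (x (y a)) = y a" using fpf_involutionD[OF x ya(1)] by simp_all
    have "x (y a) \<noteq> a" using q(2) a(2) by auto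
    moreover have "\<not> x (y a) < a"
    proof
      assume "x (y a) < a"
      then have "y (x (y a)) = y a" using ag q by (simp add: agree_below_def)
      then have "x (y a) = a" using fpf_involutionD(3)[OF y q(1)] ya(2) by simp
      then show False using \<open>x (y a) \<noteq> a\<close> by simp
    qed
    ultimately show ?thesis using q(2) fd(2) by simp
  qed
  define b where "b = (LEAST b. ?P b)"
  have b: "a < b" "x a < x b" "x b \<le> y a"
    using LeastI[of ?P, OF \<open>?P (x (y a))\<close>] unfolding b_def by blast+
  have least: "b \<le> b'" if "a < b'" "x a < x b'" "x b' \<le> y a" for b'
    unfolding b_def by (rule Least_le) (use that in blast)
  \<comment> \<open>By leastness of \<open>b\<close>, no chord of \<open>x\<close> opening between
    \<open>a\<close> and \<open>i\<close> closes in \<open>{j<..y a}\<close>. In row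
    \<open>a + 1\<close> the counts agree at column \<open>y a\<close>, and \<open>y\<close> leads
    by one at column \<open>j\<close>; removing the chords that open between \<open>a\<close> and
    \<open>i\<close> leaves the surplus.\<close>
  have region: "nests n x i j < nests n y i j" if ij: "a < i" "i \<le> b" "x a \<le> j" "j < x b" for i j
  proof -
    let ?c = "\<lambda>f j. chords n f (\<lambda>u v. Suc a \<le> u \<and> u < i \<and> v \<le> j)"
    have c: "nests n f (Suc a) j = ?c f j + nests n f i j" for f j
      by (rule chords_split) (use ij in auto)
    have "?c x (y a) = ?c x j"
    proof (rule chords_cong)
      fix u assume "u \<in> {1..2*n}" "u < x u"
      then show "Suc a \<le> u \<and> u < i \<and> x u \<le> y a \<longleftrightarrow> Suc a \<le> u \<and> u < i \<and> x u \<le> j"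
        using least[of u] ij b by (cases "x a < x u") auto
    qed
    moreover have "?c y j \<le> ?c y (y a)" by (rule chords_mono) (use ij b in auto)
    moreover have "nests n x i (y a) \<le> nests n y i (y a)" using le by (simp add: nest_le_def)
    moreover have "nests n y (Suc a) (y a) = nests n x (Suc a) (y a)"
      using agree_below_nests_Suc[OF s ag a(1) ya2] fd by simp
    moreover have "nests n y (Suc a) j = nests n x (Suc a) j + 1"
    proof -
      have "j \<le> 2*n" "\<not> y a \<le> j" using ij b(3) ya2 by linarith+
      then show ?thesis using agree_below_nests_Suc[OF s ag a(1), of j] fd(1) ij(3) by simp
    qed
    ultimately show ?thesis using c[of x j] c[of y j] c[of x "y a"] c[of y "y a"] by linarith
  qed
  \<comment> \<open>Candidates range over all naturals. A \<open>b\<close> beyond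
    \<open>2 * n\<close>, or at or beyond \<open>x a\<close> as excluded next, would require a
    surplus in an interval too short to hold a chord.\<close>
  have b_range: "b \<in> {1..2*n}"
  proof (rule ccontr)
    assume "b \<notin> {1..2*n}"
    then have "2*n < b" using b(1) by auto
    then have "nests n x (2*n) (x a) < nests n y (2*n) (x a)"
      using b fd xa(1) by (intro region) auto
    then show False using nests_zero[of "x a" "2*n" n x] nests_zero[of "x a" "2*n" n y] xa(1) by simp
  qed
  have "b < x a"
  proof (rule ccontr)
    assume "\<not> b < x a"
    then have "nests n x (x a) (x a) < nests n y (x a) (x a)" using b fd(1) by (intro region) auto
    then show False using nests_zero[of "x a" "x a" n] by simp
  qed
  then have cr: "crossing n x a b" using a(1) b b_range by (auto simp: crossing_def)
  have "nesting n x a b"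
    unfolding nesting_def
  proof (intro conjI cr ballI impI)
    fix p assume p: "p \<in> {1..2*n}" "a < p" "p < b"
    have "x p \<noteq> x a" using fpf_involutionD(3)[OF x p(1)] xa(2) p(2) by auto
    then show "x p < x a \<or> x b < x p" using least[of p] p b(3) by (meson leD le_trans linorder_cases not_less)
  qed
  moreover have "nest_le n (nest_crossing x a b) y"
    unfolding nest_le_def nests_nest_crossing[OF cr x]
  proof (intro allI)
    fix i j
    have "nests n x i j \<le> nests n y i j" using le by (simp add: nest_le_def)
    then show "nests n x i j + of_bool (a < i \<and> i \<le> b \<and> x a \<le> j \<and> j < x b) \<le> nests n y i j"
      using region[of i j] by (cases "a < i \<and> i \<le> b \<and> x a \<le> j \<and> j < x b") auto
  qed
  ultimately show ?thesis using that b(3) least by blast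
qed

text \<open>All prefix counts agree, so only nesting steps stay below \<open>y\<close>, and they are
  compared at the first point \<open>a\<close> where \<open>x\<close> and \<open>y\<close>
  differ.\<close>

lemma EL_not_closable:
  assumes x: "fpf_involution n x" and bel: "below n x (Some y)"
    and none: "\<forall>a b. \<not> closable n x (Some y) a b" and ne: "\<exists>k\<in>{1..2*n}. x k \<noteq> y k"
  shows "\<exists>z l. step n x l z \<and> below n z (Some y) \<and>
    (\<forall>w m. step n x m w \<and> below n w (Some y) \<and> w \<noteq> z \<longrightarrow> l < m \<and>
       (\<exists>v k. step n w k v \<and> below n v (Some y) \<and> k \<le> m)) \<and>
    (\<forall>v k. step n z k v \<and> below n v (Some y) \<longrightarrow> l < k)"
proof -
  have y: "fpf_involution n y" and le: "nest_le n x y" using bel by (auto simp: below_def)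
  have bel_iff: "below n w (Some y) \<longleftrightarrow> nest_le n w y" for w using y by (simp add: below_def)
  have s: "same_closers n x y"
    using eq_nests_if_not_closable[OF x bel _ none] by (simp add: same_closers_def)
  define a where "a = (LEAST a. a \<in> {1..2*n} \<and> x a \<noteq> y a)"
  have "a \<in> {1..2*n} \<and> x a \<noteq> y a" unfolding a_def by (rule LeastI_ex) (use ne in blast)
  then have a: "a \<in> {1..2*n}" "x a \<noteq> y a" by auto
  have ag: "agree_below a x y"
    unfolding agree_below_def
  proof (intro allI impI)
    fix u assume "1 \<le> u" "u < a"
    then show "x u = y u" using not_less_Least[of u "\<lambda>a. a \<in> {1..2*n} \<and> x a \<noteq> y a"] a(1)
      unfolding a_def[symmetric] by auto
  qed
  obtain b where nb: "nesting n x a b" "nest_le n (nest_crossing x a b) y" "x b \<le> y a"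
    and least: "\<And>b'. a < b' \<Longrightarrow> x a < x b' \<Longrightarrow> x b' \<le> y a \<Longrightarrow> b \<le> b'"
    using first_difference_nesting[OF x y le s ag a] by blast
  note fd = first_difference[OF x y le s ag a]
  have "a < y a" using fd by simp
  have cr: "crossing n x a b" using nb by (simp add: nesting_def)
  note D = crossingD[OF cr x]
  define z where "z = nest_crossing x a b"
  define l where "l = nest_label n a b"
  have z: "fpf_involution n z" unfolding z_def using fpf_involution_nest_crossing[OF cr x] .
  have nests1: "same_closers n (nest_crossing x a' b') y" if "crossing n x a' b'" for a' b'
    using s nests_nest_crossing[OF that x, of 1] that by (auto simp: same_closers_def crossing_def)
  have no_closing: "\<not> closing n w a' b'"
    if w: "fpf_involution n w" "same_closers n w y" "below n (close_crossing w a' b') (Some y)" for w a' b'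
  proof
    assume c: "closing n w a' b'"
    then have "closable n w (Some y) a' b'" using closing_closable[OF w(1) c w(3)] by simp
    then have "nests n w 1 b' < nests n y 1 b'" "b' \<le> 2*n"
      by (auto simp: closable_def slack_def crossing_def)
    then show False using w(2) by (auto simp: same_closers_def)
  qed
  \<comment> \<open>Source of the follow-up labels: a \<open>w\<close> that still differs from
    \<open>y\<close> at \<open>a\<close> has its own first nesting there, and the premise bounds its
    label.\<close>
  have nest_step: "\<exists>v k. step n w k v \<and> below n v (Some y) \<and> k \<le> m"
    if w: "fpf_involution n w" "nest_le n w y" "same_closers n w y" "agree_below a w y" "w a \<noteq> y a"
      and m: "\<And>b'. nesting n w a b' \<Longrightarrow>
        (\<And>c. a < c \<Longrightarrow> w a < w c \<Longrightarrow> w c \<le> y a \<Longrightarrow> b' \<le> c) \<Longrightarrow> nest_label n a b' \<le> m" for w m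
  proof -
    obtain b' where b': "nesting n w a b'" "nest_le n (nest_crossing w a b') y"
      and lb: "\<And>c. a < c \<Longrightarrow> w a < w c \<Longrightarrow> w c \<le> y a \<Longrightarrow> b' \<le> c"
      using first_difference_nesting[OF w(1) y w(2-4) a(1) w(5)] by blast
    have "step n w (nest_label n a b') (nest_crossing w a b')" using b'(1) by (auto simp: step_def)
    then show ?thesis using b'(2) m[OF b'(1) lb] unfolding bel_iff by blast
  qed
  have other: "l < m \<and> (\<exists>v k. step n w k v \<and> below n v (Some y) \<and> k \<le> m)"
    if w: "step n x m w" "below n w (Some y)" "w \<noteq> z" for w m
    using w(1)
  proof (cases rule: stepE)
    case (close a' b')
    then show ?thesis using no_closing[OF x s, of a' b'] w(2) by simp
  next
    case (nest a' b')
    have cr': "crossing n x a' b'" using nest(1) by (simp add: nesting_def)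
    note D' = crossingD[OF cr' x]
    have lew: "nest_le n w y" using w(2) by (simp add: bel_iff)
    have wf: "fpf_involution n w" unfolding nest(2) using fpf_involution_nest_crossing[OF cr' x] .
    have sw: "same_closers n w y" unfolding nest(2) using nests1[OF cr'] .
    note ge = nest_crossing_agree_below[OF x s ag cr' lew[unfolded nest(2)] a(1) \<open>a < y a\<close>]
    have lab: "nest_label n u v < m \<longleftrightarrow> u < a' \<or> u = a' \<and> v < b'" if "v \<le> 2*n" for u v
      unfolding nest(3) by (rule nest_label_less) (use that D' in auto)
    have b2: "b \<le> 2*n" using D by simp
    have agw: "agree_below a w y"
      unfolding agree_below_def
    proof (intro allI impI)
      fix u assume u: "1 \<le> u" "u < a"
      then have "w u = x u"
        unfolding nest(2) using ge(1) D' by (intro crossing_update_other) auto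
      then show "w u = y u" using ag u by (simp add: agree_below_def)
    qed
    from ge(1) consider "a < a'" | "a' = a" by linarith
    then show ?thesis
    proof cases
      case 1
      have wa: "w a = x a" unfolding nest(2) using 1 D' by (intro crossing_update_other) auto
      have "\<exists>v k. step n w k v \<and> below n v (Some y) \<and> k \<le> m"
      proof (rule nest_step[OF wf lew sw agw])
        fix b' assume "nesting n w a b'"
        then have "b' \<le> 2*n" by (auto simp: nesting_def crossing_def)
        then show "nest_label n a b' \<le> m" using lab[of b' a] 1 by simp
      qed (use wa a in simp)
      then show ?thesis using lab[OF b2] 1 unfolding l_def by blast
    next
      case 2
      have "b \<le> b'" using least[of b'] ge(2) D'(1,3) 2 by simp
      moreover have "b \<noteq> b'" using w(3) 2 unfolding nest(2) z_def by blast
      ultimately have "b < b'" by simp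
      \<comment> \<open>\<open>b\<close> lies between \<open>a\<close> and \<open>b'\<close> and
        \<open>x a < x b\<close>, so nesting at \<open>(a, b')\<close> leaves only this case. As
        \<open>w a = x b'\<close>, the point \<open>b\<close> is still a candidate in
        \<open>w\<close>, and the follow-up label does not exceed that of
        \<open>(a, b)\<close>.\<close>
      have "x b' < x b"
        using nest(1) D(1,3,5) \<open>b < b'\<close> 2 unfolding nesting_def by (meson less_asym)
      have wa: "w a = x b'" unfolding nest(2) using nest_crossing_simps(1)[OF cr'] 2 by simp
      have wb: "w b = x b"
        unfolding nest(2) by (rule crossing_update_other) (use D D' 2 \<open>b < b'\<close> \<open>x b' < x b\<close> in auto)
      have "\<exists>v k. step n w k v \<and> below n v (Some y) \<and> k \<le> m"
      proof (rule nest_step[OF wf lew sw agw])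
        show "w a \<noteq> y a" using wa \<open>x b' < x b\<close> nb(3) by simp
        fix b'' assume b'': "nesting n w a b''" "\<And>c. a < c \<Longrightarrow> w a < w c \<Longrightarrow> w c \<le> y a \<Longrightarrow> b'' \<le> c"
        have "b'' \<le> b" using b''(2)[of b] D(1) wa wb \<open>x b' < x b\<close> nb(3) by simp
        then show "nest_label n a b'' \<le> m" using lab[of b'' a] b2 2 \<open>b < b'\<close> by simp
      qed
      then show ?thesis using lab[OF b2] 2 \<open>b < b'\<close> unfolding l_def by blast
    qed
  qed
  have asc: "l < k" if v: "step n z k v" "below n v (Some y)" for v k
    using v(1)
  proof (cases rule: stepE)
    case (close a' b')
    then show ?thesis
      using no_closing[OF z, of a' b'] nests1[OF cr] v(2) by (simp add: z_def)
  next
    case (nest a' b')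
    have cr': "crossing n z a' b'" using nest(1) by (simp add: nesting_def)
    note D' = crossingD[OF cr' z]
    note g = nest_crossing_simps[OF cr, folded z_def]
    note other = crossing_update_other(2)[of _ a b x, folded z_def]
    have agz: "agree_below a z y"
      unfolding agree_below_def
    proof (intro allI impI)
      fix u assume u: "1 \<le> u" "u < a"
      then have "z u = x u" using D by (intro other) auto
      then show "z u = y u" using ag u by (simp add: agree_below_def)
    qed
    note ge = nest_crossing_agree_below[OF z _ agz cr' _ a(1) \<open>a < y a\<close>]
    have lev: "nest_le n (nest_crossing z a' b') y" using v(2) nest(2) by (simp add: bel_iff)
    have sz: "same_closers n z y" unfolding z_def using nests1[OF cr] .
    have "l < k \<longleftrightarrow> a < a' \<or> a = a' \<and> b < b'"
      unfolding l_def nest(3) by (rule nest_label_less) (use D D' in auto)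
    moreover have "a \<le> a'" using ge(1)[OF sz lev] .
    \<comment> \<open>Now \<open>z a = x b\<close>. A follow-up at \<open>a\<close> with
      \<open>b' < b\<close> would be a candidate in \<open>x\<close> smaller than
      \<open>b\<close>.\<close>
    moreover have "b < b'" if "a' = a"
    proof (rule ccontr)
      assume "\<not> b < b'"
      moreover have "b' \<noteq> b" using D' D g that by auto
      ultimately have "b' < b" by simp
      have zb: "z b' = x b'" using D D'(1) that \<open>b' < b\<close> by (intro other) auto
      have "x b' \<le> y a" using ge(2)[OF sz lev that] zb by simp
      moreover have "x a < x b'" using D'(3) D(3) g that zb by simp
      ultimately have "b \<le> b'" using least[of b'] D'(1) that by simp
      then show False using \<open>b' < b\<close> by simp
    qed
    ultimately show ?thesis by linarith
  qed
  have "step n x l z" unfolding step_def l_def z_def using nb(1) by blast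
  then show ?thesis using nb(2) other asc unfolding z_def bel_iff by blast
qed

section \<open>The uncrossing poset\<close>

lemma step_exists_first:
  assumes x: "fpf_involution n x" and bel: "below n x t"
    and ne: "case t of None \<Rightarrow> \<exists>u v. crossing n x u v | Some y \<Rightarrow> \<exists>k\<in>{1..2*n}. x k \<noteq> y k"
  shows "\<exists>z l. step n x l z \<and> below n z t \<and> (t = None \<longrightarrow> l < top_label n) \<and>
    (\<forall>w m. step n x m w \<and> below n w t \<and> w \<noteq> z \<longrightarrow> l < m \<and>
      (t = None \<and> (\<forall>u v. \<not> crossing n w u v) \<and> top_label n \<le> m \<or>
       (\<exists>v k. step n w k v \<and> below n v t \<and> k \<le> m))) \<and>
    (\<forall>v k. step n z k v \<and> below n v t \<longrightarrow> l < k)"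
proof (cases "\<exists>a b. closable n x t a b")
  case True
  then obtain a b where "closable n x t a b" by blast
  from EL_closable[OF x bel this] show ?thesis by blast
next
  case False
  then obtain y where y: "t = Some y" using ne by (cases t) (auto simp: closable_def slack_def)
  have "\<exists>k\<in>{1..2*n}. x k \<noteq> y k" using ne y by simp
  then show ?thesis using EL_not_closable[OF x, of y] bel False unfolding y by simp
qed

section \<open>Matchings as fixed-point free involutions\<close>

definition mate :: "nat \<Rightarrow> nat set set \<Rightarrow> nat \<Rightarrow> nat" where
  "mate n M k = (if k \<in> {1..2*n} then THE l. {k, l} \<in> M else 0)"

definition matching_of :: "nat \<Rightarrow> (nat \<Rightarrow> nat) \<Rightarrow> nat set set" where
  "matching_of n f = (\<lambda>k. {k, f k}) ` {1..2*n}"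

lemma mate_iff:
  assumes M: "M \<in> matchings n"
  shows "{k, l} \<in> M \<longleftrightarrow> k \<in> {1..2*n} \<and> mate n M k = l"
proof -
  have un: "\<Union>M = {1..2*n}" and dis: "disjoint M" and two: "\<And>e. e \<in> M \<Longrightarrow> card e = 2"
    using M by (auto simp: matchings_def partition_on_def)
  have uniq: "l = l'" if "{k, l} \<in> M" "{k, l'} \<in> M" for k l l'
  proof -
    have "{k, l} = {k, l'}" using disjointD[OF dis that] by blast
    then show ?thesis by (auto simp: doubleton_eq_iff)
  qed
  have "{k, mate n M k} \<in> M" if k: "k \<in> {1..2*n}" for k
  proof -
    obtain e where e: "e \<in> M" "k \<in> e" using un k by blast
    then obtain l where "e = {k, l}" using two[of e] by (auto simp: card_2_iff)
    then have "\<exists>!l. {k, l} \<in> M" using e uniq by blast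
    then show ?thesis using k theI'[of "\<lambda>l. {k, l} \<in> M"] by (simp add: mate_def)
  qed
  moreover have "k \<in> {1..2*n}" if "{k, l} \<in> M" using that un by blast
  ultimately show ?thesis using uniq[of k l "mate n M k"] by metis
qed

lemma fpf_involution_mate:
  assumes M: "M \<in> matchings n"
  shows "fpf_involution n (mate n M)"
  unfolding fpf_involution_def
proof
  fix k assume k: "k \<in> {1..2*n}"
  have e: "{k, mate n M k} \<in> M" using k mate_iff[OF M] by blast
  then have "card {k, mate n M k} = 2" using M unfolding matchings_def by blast
  then have "mate n M k \<noteq> k" by (cases "mate n M k = k") simp_all
  moreover have "{mate n M k, k} \<in> M" using e by (simp add: insert_commute)
  ultimately show "mate n M k \<in> {1..2*n} \<and> mate n M k \<noteq> k \<and> mate n M (mate n M k) = k"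
    using mate_iff[OF M] by blast
qed

lemma matching_of_mate:
  assumes M: "M \<in> matchings n"
  shows "matching_of n (mate n M) = M"
proof
  show "matching_of n (mate n M) \<subseteq> M"
    unfolding matching_of_def by (rule image_subsetI) (simp only: mate_iff[OF M])
  show "M \<subseteq> matching_of n (mate n M)"
  proof
    fix e assume e: "e \<in> M"
    then have "card e = 2" using M unfolding matchings_def by blast
    then obtain k l where kl: "e = {k, l}" unfolding card_2_iff by blast
    then have "k \<in> {1..2*n}" "mate n M k = l" using e mate_iff[OF M] by blast+
    then show "e \<in> matching_of n (mate n M)" unfolding matching_of_def kl by blast
  qed
qed

lemma matching_of_matchings:
  assumes f: "fpf_involution n f"
  shows "matching_of n f \<in> matchings n"
  unfolding matchings_def partition_on_def
proof (intro CollectI conjI ballI)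
  show "\<Union> (matching_of n f) = {1..2*n}"
  proof (intro equalityI subsetI)
    fix p assume "p \<in> \<Union> (matching_of n f)"
    then obtain k where k: "k \<in> {1..2*n}" "p \<in> {k, f k}" unfolding matching_of_def by blast
    then show "p \<in> {1..2*n}" using fpf_involutionD(1)[OF f k(1)] by blast
  next
    fix p assume "p \<in> {1..2*n}"
    then show "p \<in> \<Union> (matching_of n f)" unfolding matching_of_def by blast
  qed
  show "disjoint (matching_of n f)"
    unfolding disjoint_def
  proof (intro ballI impI)
    fix e e' assume ee: "e \<in> matching_of n f" "e' \<in> matching_of n f" "e \<noteq> e'"
    have *: "d = {p, f p}" if d: "d \<in> matching_of n f" "p \<in> d" for d p
    proof -
      obtain k where k: "k \<in> {1..2*n}" "d = {k, f k}" using d(1) unfolding matching_of_def by blast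
      have "p = k \<or> p = f k" using d(2) k(2) by simp
      then show ?thesis using k(2) fpf_involutionD(3)[OF f k(1)] by (elim disjE) (simp_all add: insert_commute)
    qed
    show "e \<inter> e' = {}"
    proof (rule ccontr)
      assume "e \<inter> e' \<noteq> {}"
      then obtain p where p: "p \<in> e" "p \<in> e'" by blast
      show False using *[OF ee(1) p(1)] *[OF ee(2) p(2)] ee(3) by simp
    qed
  qed
  show "{} \<notin> matching_of n f" unfolding matching_of_def by blast
  fix e assume "e \<in> matching_of n f"
  then obtain k where k: "k \<in> {1..2*n}" "e = {k, f k}" unfolding matching_of_def by blast
  show "card e = 2" unfolding k(2) using fpf_involutionD(2)[OF f k(1)] by simp
qed

lemma mate_outside: "k \<notin> {1..2*n} \<Longrightarrow> mate n M k = 0"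
  unfolding mate_def by (rule if_not_P)

text \<open>The default value 0 outside \<open>{1..2*n}\<close> gives each matching a single
  function, so results of steps can be compared as functions.\<close>

lemma mate_matching_of:
  assumes f: "fpf_involution n f" and out: "\<And>k. k \<notin> {1..2*n} \<Longrightarrow> f k = 0"
  shows "mate n (matching_of n f) = f"
proof
  fix k show "mate n (matching_of n f) k = f k"
  proof (cases "k \<in> {1..2*n}")
    case True
    then have "{k, f k} \<in> matching_of n f" unfolding matching_of_def by blast
    then show ?thesis unfolding mate_iff[OF matching_of_matchings[OF f]] by blast
  next
    case False
    then show ?thesis using mate_outside out by simp
  qed
qed

lemma mate_inj:
  assumes "M \<in> matchings n" "N \<in> matchings n" "mate n M = mate n N"
  shows "M = N"
  using matching_of_mate assms by metis

lemma mate_cong: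
  assumes "\<forall>k\<in>{1..2*n}. mate n M k = mate n N k"
  shows "mate n M = mate n N"
proof
  fix k show "mate n M k = mate n N k"
  proof (cases "k \<in> {1..2*n}")
    case True
    then show ?thesis using assms by blast
  next
    case False
    then show ?thesis using mate_outside[of k n M] mate_outside[of k n N] by simp
  qed
qed

text \<open>Crossing pairs are indexed by their two openers, which turns their number into the
  double sum \<open>crossings\<close>.\<close>

lemma crossing_pairs_eq:
  assumes M: "M \<in> matchings n"
  shows "crossing_pairs M = (\<lambda>(u, v). ({u, mate n M u}, {v, mate n M v})) ` {(u, v). crossing n (mate n M) u v}"
    (is "_ = ?h ` ?C")
proof
  note f = fpf_involution_mate[OF M] and iff = mate_iff[OF M]
  show "crossing_pairs M \<subseteq> ?h ` ?C"
  proof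
    fix p assume "p \<in> crossing_pairs M"
    then obtain a b c d where abcd: "a < b" "b < c" "c < d" "p = ({a, c}, {b, d})" "{a, c} \<in> M" "{b, d} \<in> M"
      by (auto simp: crossing_pairs_def)
    then have "mate n M a = c" "mate n M b = d" "a \<in> {1..2*n}" "b \<in> {1..2*n}" using iff by blast+
    then have "(a, b) \<in> ?C" "p = ?h (a, b)" using abcd by (auto simp: crossing_def)
    then show "p \<in> ?h ` ?C" by blast
  qed
  show "?h ` ?C \<subseteq> crossing_pairs M"
  proof clarify
    fix u v assume c: "crossing n (mate n M) u v"
    note D = crossingD[OF c f]
    have "{u, mate n M u} \<in> M" "{v, mate n M v} \<in> M" using iff D(4,5) by blast+
    then show "({u, mate n M u}, {v, mate n M v}) \<in> crossing_pairs M"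
      unfolding crossing_pairs_def using D(1-3) by blast
  qed
qed

lemma crossings_card:
  "crossings n f = int (card {(u, v). crossing n f u v})"
proof -
  let ?S = "{1..2*n} \<times> {1..2*n}"
  have "crossings n f = (\<Sum>(u, v)\<in>?S. of_bool (u < v \<and> v < f u \<and> f u < f v))"
    unfolding crossings_def by (rule sum.cartesian_product)
  also have "\<dots> = (\<Sum>p\<in>{(u, v). crossing n f u v}. 1)"
    by (rule sum.mono_neutral_cong_right) (auto simp: crossing_def)
  finally show ?thesis by simp
qed

lemma card_crossing_pairs:
  assumes M: "M \<in> matchings n"
  shows "int (card (crossing_pairs M)) = crossings n (mate n M)"
proof -
  have "inj_on (\<lambda>(u, v). ({u, mate n M u}, {v, mate n M v})) {(u, v). crossing n (mate n M) u v}"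
    by (rule inj_onI) (auto simp: crossing_def doubleton_eq_iff)
  then show ?thesis unfolding crossing_pairs_eq[OF M] crossings_card by (simp add: card_image)
qed

lemma crossing_pairs_empty_iff:
  assumes M: "M \<in> matchings n"
  shows "crossing_pairs M = {} \<longleftrightarrow> (\<forall>u v. \<not> crossing n (mate n M) u v)"
  unfolding crossing_pairs_eq[OF M] by auto

text \<open>\<open>T\<close> is a union of chords of \<open>f\<close>, so the set difference removes
  exactly the chords at \<open>T\<close> and none of the others.\<close>

lemma matching_of_change:
  assumes T: "T \<subseteq> {1..2*n}" and fT: "\<And>t. t \<in> T \<Longrightarrow> f t \<in> T" and g: "\<And>k. k \<notin> T \<Longrightarrow> g k = f k"
  shows "matching_of n g = matching_of n f - (\<lambda>k. {k, f k}) ` T \<union> (\<lambda>k. {k, g k}) ` T"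
proof -
  have split: "matching_of n h = (\<lambda>k. {k, h k}) ` ({1..2*n} - T) \<union> (\<lambda>k. {k, h k}) ` T" for h
    unfolding matching_of_def image_Un[symmetric] using T by (simp add: Un_absorb2)
  have "(\<lambda>k. {k, g k}) ` ({1..2*n} - T) = (\<lambda>k. {k, f k}) ` ({1..2*n} - T)"
    by (rule image_cong) (simp_all add: g)
  moreover have "{k, f k} \<noteq> {t, f t}" if "k \<notin> T" "t \<in> T" for k t
    using that fT by (auto simp: doubleton_eq_iff)
  then have "(\<lambda>k. {k, f k}) ` ({1..2*n} - T) \<inter> (\<lambda>k. {k, f k}) ` T = {}" by blast
  ultimately show ?thesis unfolding split[of f] split[of g] by blast
qed

lemma matching_of_close_crossing:
  assumes f: "fpf_involution n f" and c: "crossing n f a b"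
  shows "matching_of n (close_crossing f a b) =
    matching_of n f - {{a, f a}, {b, f b}} \<union> {{a, b}, {f a, f b}}"
proof -
  note D = crossingD[OF c f]
  let ?T = "{a, b, f a, f b}" and ?g = "close_crossing f a b"
  have T: "?T \<subseteq> {1..2*n}" using D(4-7) by (simp only: insert_subset empty_subsetI simp_thms)
  have fT: "f t \<in> ?T" if "t \<in> ?T" for t
    using that by (elim insertE emptyE) (simp_all add: D(8,9))
  have "(\<lambda>k. {k, ?g k}) ` ?T = {{a, b}, {f a, f b}}"
    unfolding image_insert image_empty close_crossing_simps[OF c] by (simp add: insert_commute)
  moreover have "(\<lambda>k. {k, f k}) ` ?T = {{a, f a}, {b, f b}}"
    unfolding image_insert image_empty D(8,9) by (simp add: insert_commute)
  moreover have "matching_of n ?g = matching_of n f - (\<lambda>k. {k, f k}) ` ?T \<union> (\<lambda>k. {k, ?g k}) ` ?T"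
    by (rule matching_of_change[OF T]) (fact fT, rule crossing_update_other(1))
  ultimately show ?thesis by (simp only:)
qed

lemma matching_of_nest_crossing:
  assumes f: "fpf_involution n f" and c: "crossing n f a b"
  shows "matching_of n (nest_crossing f a b) =
    matching_of n f - {{a, f a}, {b, f b}} \<union> {{a, f b}, {b, f a}}"
proof -
  note D = crossingD[OF c f]
  let ?T = "{a, b, f a, f b}" and ?g = "nest_crossing f a b"
  have T: "?T \<subseteq> {1..2*n}" using D(4-7) by (simp only: insert_subset empty_subsetI simp_thms)
  have fT: "f t \<in> ?T" if "t \<in> ?T" for t
    using that by (elim insertE emptyE) (simp_all add: D(8,9))
  have "(\<lambda>k. {k, ?g k}) ` ?T = {{a, f b}, {b, f a}}"
    unfolding image_insert image_empty nest_crossing_simps[OF c] by (simp add: insert_commute)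
  moreover have "(\<lambda>k. {k, f k}) ` ?T = {{a, f a}, {b, f b}}"
    unfolding image_insert image_empty D(8,9) by (simp add: insert_commute)
  moreover have "matching_of n ?g = matching_of n f - (\<lambda>k. {k, f k}) ` ?T \<union> (\<lambda>k. {k, ?g k}) ` ?T"
    by (rule matching_of_change[OF T]) (fact fT, rule crossing_update_other(2))
  ultimately show ?thesis by (simp only:)
qed

lemma uncrosses_to_iff:
  assumes M: "M \<in> matchings n"
  shows "uncrosses_to M N \<longleftrightarrow> (\<exists>a b. crossing n (mate n M) a b \<and>
    (N = matching_of n (close_crossing (mate n M) a b) \<or> N = matching_of n (nest_crossing (mate n M) a b)))"
proof -
  let ?f = "mate n M"
  note f = fpf_involution_mate[OF M] and iff = mate_iff[OF M]
  have ex: "(a < b \<and> b < c \<and> c < d \<and> {a, c} \<in> M \<and> {b, d} \<in> M) \<longleftrightarrow> crossing n ?f a b \<and> ?f a = c \<and> ?f b = d"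
    for a b c d using iff by (auto simp: crossing_def)
  have "uncrosses_to M N \<longleftrightarrow> (\<exists>a b c d. (a < b \<and> b < c \<and> c < d \<and> {a, c} \<in> M \<and> {b, d} \<in> M) \<and>
    (N = M - {{a, c}, {b, d}} \<union> {{a, b}, {c, d}} \<or> N = M - {{a, c}, {b, d}} \<union> {{a, d}, {b, c}}))"
    unfolding uncrosses_to_def by blast
  also have "\<dots> \<longleftrightarrow> (\<exists>a b. crossing n ?f a b \<and>
    (N = M - {{a, ?f a}, {b, ?f b}} \<union> {{a, b}, {?f a, ?f b}} \<or>
     N = M - {{a, ?f a}, {b, ?f b}} \<union> {{a, ?f b}, {b, ?f a}}))"
    unfolding ex by blast
  also have "\<dots> \<longleftrightarrow> (\<exists>a b. crossing n ?f a b \<and>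
    (N = matching_of n (close_crossing ?f a b) \<or> N = matching_of n (nest_crossing ?f a b)))"
    using matching_of_close_crossing[OF f] matching_of_nest_crossing[OF f]
    unfolding matching_of_mate[OF M] by metis
  finally show ?thesis .
qed

lemma step_fpf_involution:
  assumes "step n f l g" "fpf_involution n f"
  shows "fpf_involution n g"
  using assms(1)
  by (cases rule: stepE)
    (auto simp: closing_def nesting_def intro: fpf_involution_close_crossing fpf_involution_nest_crossing assms(2))

lemma step_crossings:
  assumes "step n f l g" "fpf_involution n f"
  shows "crossings n g = crossings n f - 1"
  using assms(1)
  by (cases rule: stepE)
    (auto simp: closing_def nesting_def crossings_close_crossing[OF _ assms(2)] crossings_nest_crossing[OF _ assms(2)])

lemma step_outside:
  assumes s: "step n f l g" and f: "fpf_involution n f" and k: "k \<notin> {1..2*n}"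
  shows "g k = f k"
proof -
  have out: "k \<notin> {a, b, f a, f b}" if "crossing n f a b" for a b
    using k crossingD(4-7)[OF that f] by blast
  from s show ?thesis
  proof (cases rule: stepE)
    case (close a b)
    then have "crossing n f a b" by (simp add: closing_def)
    from crossing_update_other(1)[OF out[OF this]] show ?thesis unfolding close(2) .
  next
    case (nest a b)
    then have "crossing n f a b" by (simp add: nesting_def)
    from crossing_update_other(2)[OF out[OF this]] show ?thesis unfolding nest(2) .
  qed
qed

lemma step_mate:
  assumes M: "M \<in> matchings n" and s: "step n (mate n M) l g"
  shows "matching_of n g \<in> matchings n" "mate n (matching_of n g) = g"
  using step_fpf_involution[OF s] step_outside[OF s] fpf_involution_mate[OF M] mate_outside
  by (auto intro!: matching_of_matchings mate_matching_of)

lemma step_crossing: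
  assumes "step n f l g" shows "\<exists>u v. crossing n f u v"
  using assms by (cases rule: stepE) (auto simp: closing_def nesting_def)

text \<open>The rank condition says that exactly one crossing is lost, which the crossing lemmas
  identify with the third-strand conditions in \<open>closing\<close> and
  \<open>nesting\<close>.\<close>

lemma covers_iff_step:
  assumes M: "M \<in> matchings n" and N: "N \<in> matchings n"
  shows "(Some N, Some M) \<in> uncrossing_covers n \<longleftrightarrow> (\<exists>l. step n (mate n M) l (mate n N))"
proof
  note f = fpf_involution_mate[OF M]
  assume "(Some N, Some M) \<in> uncrossing_covers n"
  then have u: "uncrosses_to M N" and r: "card (crossing_pairs M) = card (crossing_pairs N) + 1"
    by (auto simp: uncrossing_covers_def)
  have r': "crossings n (mate n N) = crossings n (mate n M) - 1"
    using r card_crossing_pairs[OF M] card_crossing_pairs[OF N] by linarith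
  obtain a b where c: "crossing n (mate n M) a b"
    and N': "N = matching_of n (close_crossing (mate n M) a b) \<or> N = matching_of n (nest_crossing (mate n M) a b)"
    using u unfolding uncrosses_to_iff[OF M] by blast
  have out: "close_crossing (mate n M) a b k = 0" "nest_crossing (mate n M) a b k = 0" if "k \<notin> {1..2*n}" for k
  proof -
    have "k \<notin> {a, b, mate n M a, mate n M b}" using that crossingD(4-7)[OF c f] by blast
    then show "close_crossing (mate n M) a b k = 0" "nest_crossing (mate n M) a b k = 0"
      using mate_outside[OF that] by (simp_all add: crossing_update_other)
  qed
  have m: "mate n N = close_crossing (mate n M) a b \<or> mate n N = nest_crossing (mate n M) a b"
    using N' mate_matching_of[OF fpf_involution_close_crossing[OF c f] out(1)]
      mate_matching_of[OF fpf_involution_nest_crossing[OF c f] out(2)] by blast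
  show "\<exists>l. step n (mate n M) l (mate n N)"
    using m
  proof
    assume *: "mate n N = close_crossing (mate n M) a b"
    then have "closing n (mate n M) a b"
      using r' c crossings_close_crossing[OF c f] by (simp add: closing_def)
    then show ?thesis using * unfolding step_def by blast
  next
    assume *: "mate n N = nest_crossing (mate n M) a b"
    then have "nesting n (mate n M) a b"
      using r' c crossings_nest_crossing[OF c f] by (simp add: nesting_def)
    then show ?thesis using * unfolding step_def by blast
  qed
next
  note f = fpf_involution_mate[OF M]
  assume "\<exists>l. step n (mate n M) l (mate n N)"
  then obtain l where s: "step n (mate n M) l (mate n N)" ..
  have "int (card (crossing_pairs N)) = int (card (crossing_pairs M)) - 1"
    using step_crossings[OF s f] card_crossing_pairs[OF M] card_crossing_pairs[OF N] by simp
  moreover have "uncrosses_to M N"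
    unfolding uncrosses_to_iff[OF M] using s matching_of_mate[OF N]
    by (cases rule: stepE) (auto simp: closing_def nesting_def)
  ultimately show "(Some N, Some M) \<in> uncrossing_covers n"
    using M N by (auto simp: uncrossing_covers_def)
qed

lemma covers_None_iff:
  assumes M: "M \<in> matchings n"
  shows "(None, Some M) \<in> uncrossing_covers n \<longleftrightarrow> (\<forall>u v. \<not> crossing n (mate n M) u v)"
  using M crossing_pairs_empty_iff[OF M] by (auto simp: uncrossing_covers_def)

text \<open>\<open>a\<close> is recovered as the first point whose partner changes. That partner
  moves left to \<open>b\<close> in a closing step and right to \<open>f b\<close> in a nesting
  step, which reveals the kind of step and the rest of the label.\<close>

lemma step_label_unique:
  assumes f: "fpf_involution n f" and s: "step n f l g" and s': "step n f l' g"
  shows "l = l'"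
proof -
  let ?move = "\<lambda>a b l. g = close_crossing f a b \<and> l = close_label n a (f b) \<or>
    g = nest_crossing f a b \<and> l = nest_label n a b"
  have info: "g a = b \<and> b < f a \<and> l = close_label n a (f b) \<or> g a = f b \<and> f a < f b \<and> l = nest_label n a b"
    if c: "crossing n f a b" and g: "?move a b l" for a b l
    using g
  proof
    assume "g = close_crossing f a b \<and> l = close_label n a (f b)"
    then show ?thesis using close_crossing_simps(1)[OF c] crossingD(2)[OF c f] by simp
  next
    assume "g = nest_crossing f a b \<and> l = nest_label n a b"
    then show ?thesis using nest_crossing_simps(1)[OF c] crossingD(3)[OF c f] by simp
  qed
  have changed: "g a \<noteq> f a" if "crossing n f a b" "?move a b l" for a b l
    using info[OF that] by (elim disjE conjE) simp_all
  have first: "a \<le> u" if c: "crossing n f a b" and g: "?move a b l" and u: "g u \<noteq> f u" for a b l u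
  proof -
    have "u \<in> {a, b, f a, f b}" using u g crossing_update_other[of u a b f] by metis
    then show ?thesis using crossingD(1-3)[OF c f] by (elim insertE emptyE) simp_all
  qed
  obtain a b where c: "crossing n f a b" and g: "?move a b l"
    using s unfolding step_def closing_def nesting_def by blast
  obtain a' b' where c': "crossing n f a' b'" and g': "?move a' b' l'"
    using s' unfolding step_def closing_def nesting_def by blast
  have "a = a'"
    using first[OF c g changed[OF c' g']] first[OF c' g' changed[OF c g]] by simp
  moreover have "b = b'" if "f b = f b'"
    using that crossingD(9)[OF c f] crossingD(9)[OF c' f] by metis
  ultimately show ?thesis using info[OF c g] info[OF c' g'] by (elim disjE conjE) simp_all
qed

section \<open>The uncrossing order as comparison of nesting counts\<close>

lemma nest_le_step:
  assumes s: "step n f l g" and f: "fpf_involution n f"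
  shows "nest_le n f g"
  using s
proof (cases rule: stepE)
  case (close a b)
  then have "crossing n f a b" by (simp add: closing_def)
  from nests_close_crossing[OF this f] show ?thesis unfolding nest_le_def close(2) by simp
next
  case (nest a b)
  then have "crossing n f a b" by (simp add: nesting_def)
  from nests_nest_crossing[OF this f] show ?thesis unfolding nest_le_def nest(2) by simp
qed

lemma covers_imp_nest_le:
  assumes "(Some N, Some M) \<in> (uncrossing_covers n)\<^sup>*" and N: "N \<in> matchings n"
  shows "M \<in> matchings n \<and> nest_le n (mate n M) (mate n N)"
proof -
  have "\<exists>M. v = Some M \<and> M \<in> matchings n \<and> nest_le n (mate n M) (mate n N)"
    if "(Some N, v) \<in> (uncrossing_covers n)\<^sup>*" for v
    using that
  proof (induction rule: rtrancl_induct)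
    case base
    then show ?case using N by (simp add: nest_le_def)
  next
    case (step v w)
    obtain M where M: "v = Some M" "M \<in> matchings n" "nest_le n (mate n M) (mate n N)" using step.IH by blast
    obtain M' where M': "w = Some M'" "M' \<in> matchings n"
      using step.hyps(2) by (auto simp: uncrossing_covers_def)
    obtain l where s: "step n (mate n M') l (mate n M)"
      using step.hyps(2) covers_iff_step[OF M'(2) M(2)] unfolding M(1) M'(1) by blast
    have "nest_le n (mate n M') (mate n M)" using nest_le_step[OF s fpf_involution_mate[OF M'(2)]] .
    then have "nest_le n (mate n M') (mate n N)"
      using M(3) unfolding nest_le_def by (meson order_trans)
    then show ?case using M' by blast
  qed
  then show ?thesis using assms(1) by blast
qed

text \<open>As long as the matchings differ, \<open>step_exists_first\<close> provides a step that
  stays below the target and loses one crossing. The choice made for the shelling thus also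
  identifies the order.\<close>

lemma nest_le_imp_covers:
  assumes M: "M \<in> matchings n" and N: "N \<in> matchings n" and le: "nest_le n (mate n M) (mate n N)"
  shows "(Some N, Some M) \<in> (uncrossing_covers n)\<^sup>*"
  using M le
proof (induction "card (crossing_pairs M)" arbitrary: M rule: less_induct)
  case less
  note f = fpf_involution_mate[OF less.prems(1)]
  show ?case
  proof (cases "\<forall>k\<in>{1..2*n}. mate n M k = mate n N k")
    case True
    then show ?thesis using mate_inj[OF less.prems(1) N] mate_cong by blast
  next
    case False
    have bel: "below n (mate n M) (Some (mate n N))"
      using less.prems(2) fpf_involution_mate[OF N] by (simp add: below_def)
    have "\<exists>k\<in>{1..2*n}. mate n M k \<noteq> mate n N k" using False by blast
    then obtain z l where z: "step n (mate n M) l z" "below n z (Some (mate n N))"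
      using step_exists_first[OF f bel, unfolded option.case] by blast
    define Z where "Z = matching_of n z"
    have Z: "Z \<in> matchings n" "mate n Z = z" using step_mate[OF less.prems(1) z(1)] by (simp_all add: Z_def)
    have "int (card (crossing_pairs Z)) = int (card (crossing_pairs M)) - 1"
      using step_crossings[OF z(1) f] card_crossing_pairs[OF Z(1)] card_crossing_pairs[OF less.prems(1)] Z(2) by simp
    then have "card (crossing_pairs Z) < card (crossing_pairs M)" by linarith
    moreover have "nest_le n (mate n Z) (mate n N)" using z(2) Z(2) by (simp add: below_def)
    ultimately have "(Some N, Some Z) \<in> (uncrossing_covers n)\<^sup>*" using less.hyps Z(1) by blast
    moreover have "(Some Z, Some M) \<in> uncrossing_covers n"
      using covers_iff_step[OF less.prems(1) Z(1)] z(1) Z(2) by blast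
    ultimately show ?thesis by (rule rtrancl_into_rtrancl)
  qed
qed

text \<open>The same induction with the empty target: steps exist until no crossing is left.\<close>

lemma None_covers:
  assumes M: "M \<in> matchings n"
  shows "(None, Some M) \<in> (uncrossing_covers n)\<^sup>*"
  using M
proof (induction "card (crossing_pairs M)" arbitrary: M rule: less_induct)
  case less
  note f = fpf_involution_mate[OF less.prems]
  show ?case
  proof (cases "\<exists>u v. crossing n (mate n M) u v")
    case False
    then show ?thesis using covers_None_iff[OF less.prems] by blast
  next
    case True
    have "below n (mate n M) None" by (simp add: below_def)
    from step_exists_first[OF f this, unfolded option.case, OF True]
    obtain z l where z: "step n (mate n M) l z" by blast
    define Z where "Z = matching_of n z"
    have Z: "Z \<in> matchings n" "mate n Z = z" using step_mate[OF less.prems z] by (simp_all add: Z_def)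
    have "int (card (crossing_pairs Z)) = int (card (crossing_pairs M)) - 1"
      using step_crossings[OF z f] card_crossing_pairs[OF Z(1)] card_crossing_pairs[OF less.prems] Z(2) by simp
    then have "card (crossing_pairs Z) < card (crossing_pairs M)" by linarith
    then have "(None, Some Z) \<in> (uncrossing_covers n)\<^sup>*" using less.hyps Z(1) by blast
    moreover have "(Some Z, Some M) \<in> uncrossing_covers n"
      using covers_iff_step[OF less.prems Z(1)] z Z(2) by blast
    ultimately show ?thesis by (rule rtrancl_into_rtrancl)
  qed
qed

lemma order_Some_iff:
  "(Some N, Some M) \<in> uncrossing_order n \<longleftrightarrow>
    N \<in> matchings n \<and> M \<in> matchings n \<and> nest_le n (mate n M) (mate n N)"
proof
  assume "(Some N, Some M) \<in> uncrossing_order n"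
  then have "(Some N, Some M) \<in> (uncrossing_covers n)\<^sup>*" and N: "N \<in> matchings n"
    by (auto simp: uncrossing_order_def uncrossing_poset_def)
  from covers_imp_nest_le[OF this] N show "N \<in> matchings n \<and> M \<in> matchings n \<and> nest_le n (mate n M) (mate n N)"
    by blast
next
  assume *: "N \<in> matchings n \<and> M \<in> matchings n \<and> nest_le n (mate n M) (mate n N)"
  then have "(Some N, Some M) \<in> (uncrossing_covers n)\<^sup>*" using nest_le_imp_covers by blast
  then show "(Some N, Some M) \<in> uncrossing_order n"
    using * by (simp add: uncrossing_order_def uncrossing_poset_def)
qed

lemma order_None_left: "(None, v) \<in> uncrossing_order n \<longleftrightarrow> v \<in> uncrossing_poset n"
proof
  assume "v \<in> uncrossing_poset n"
  moreover from this have "(None, v) \<in> (uncrossing_covers n)\<^sup>*"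
    using None_covers by (cases v) (auto simp: uncrossing_poset_def)
  ultimately show "(None, v) \<in> uncrossing_order n" by (simp add: uncrossing_order_def uncrossing_poset_def)
qed (simp add: uncrossing_order_def)

lemma order_None_right: "(u, None) \<in> uncrossing_order n \<longleftrightarrow> u = None"
proof
  assume "(u, None) \<in> uncrossing_order n"
  then have "(u, None) \<in> (uncrossing_covers n)\<^sup>*" by (simp add: uncrossing_order_def)
  then show "u = None" by (cases rule: rtranclE) (auto simp: uncrossing_covers_def)
qed (simp add: uncrossing_order_def uncrossing_poset_def)

lemma below_mate_iff:
  assumes "M \<in> matchings n" "y \<in> uncrossing_poset n"
  shows "below n (mate n M) (map_option (mate n) y) \<longleftrightarrow> (y, Some M) \<in> uncrossing_order n"
proof (cases y)
  case None
  then show ?thesis using assms(1) by (simp add: below_def order_None_left uncrossing_poset_def)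
next
  case (Some N)
  then have N: "N \<in> matchings n" using assms(2) by (auto simp: uncrossing_poset_def)
  show ?thesis using Some N assms(1) fpf_involution_mate[OF N] by (simp add: below_def order_Some_iff)
qed

section \<open>The largest matching\<close>

lemma nests_ge:
  assumes f: "fpf_involution n f" and i: "1 \<le> i" "i \<le> 2*n" and j: "j \<le> 2*n"
  shows "int j + 1 - int i - int n \<le> nests n f i j"
proof -
  have nonneg: "0 \<le> chords n f P" for P unfolding chords_def by (rule sum_nonneg) simp
  have all: "nests n f 1 (2*n) = chords n f (\<lambda>u v. True)"
  proof (rule chords_cong)
    fix u assume u: "u \<in> {1..2*n}"
    show "1 \<le> u \<and> f u \<le> 2*n \<longleftrightarrow> True" using fpf_involutionD(1)[OF f u] u by simp
  qed
  let ?L = "chords n f (\<lambda>u v. u \<le> i - 1)" and ?R = "chords n f (\<lambda>u v. \<not> v \<le> j)"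
  \<comment> \<open>Of the \<open>n\<close> chords, those missing from \<open>{i..j}\<close> open
    before \<open>i\<close>, at most \<open>i - 1\<close> of them, or close after \<open>j\<close>,
    at most \<open>2 * n - j\<close> of them.\<close>
  have "chords n f (\<lambda>u v. True) = nests n f i j + chords n f (\<lambda>u v. u < i \<or> \<not> v \<le> j)"
    by (rule chords_split) auto
  moreover have "chords n f (\<lambda>u v. u < i \<or> \<not> v \<le> j) = ?L + chords n f (\<lambda>u v. i \<le> u \<and> \<not> v \<le> j)"
    by (rule chords_split) (use i in auto)
  moreover have "chords n f (\<lambda>u v. i \<le> u \<and> \<not> v \<le> j) \<le> ?R" by (rule chords_mono) blast
  moreover have "?L \<le> int i - 1"
  proof -
    have "i - 1 \<le> 2*n" using i(2) by linarith
    from openers_plus_closers[OF f this] nonneg[of "\<lambda>u v. 1 \<le> u \<and> v \<le> i - 1"]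
    have "?L \<le> int (i - 1)" by linarith
    then show ?thesis using i(1) by simp
  qed
  moreover have "chords n f (\<lambda>u v. True) = nests n f 1 j + ?R" by (rule chords_split) auto
  moreover have "chords n f (\<lambda>u v. u \<le> j) \<le> chords n f (\<lambda>u v. True)" by (rule chords_mono) blast
  ultimately show ?thesis
    using openers_plus_closers[OF f j] nests_total[OF f] all by linarith
qed

text \<open>All strands of this matching cross each other, and it attains the bound of
  \<open>nests_ge\<close> wherever it has nested chords at all. The value 0 outside the range
  matches \<open>mate\<close>.\<close>

definition antipode :: "nat \<Rightarrow> nat \<Rightarrow> nat" where
  "antipode n k = (if k \<in> {1..n} then k + n else if k \<in> {n<..2*n} then k - n else 0)"

lemma fpf_involution_antipode: "fpf_involution n (antipode n)"
  unfolding fpf_involution_def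
proof
  fix k assume "k \<in> {1..2*n}"
  then show "antipode n k \<in> {1..2*n} \<and> antipode n k \<noteq> k \<and> antipode n (antipode n k) = k"
    by (cases "k \<le> n") (auto simp: antipode_def)
qed

lemma nest_le_antipode:
  assumes f: "fpf_involution n f"
  shows "nest_le n (antipode n) f"
  unfolding nest_le_def
proof (intro allI)
  fix i j
  let ?N = "nests n (antipode n) i j"
  have nonneg: "0 \<le> nests n f i j" unfolding chords_def by (rule sum_nonneg) simp
  show "?N \<le> nests n f i j"
  proof (cases "?N > 0")
    case True
    then obtain u where u: "u \<in> {1..2*n}" "u < antipode n u" "i \<le> u" "antipode n u \<le> j"
      unfolding chords_pos_iff by blast
    then have un: "u \<le> n" "antipode n u = u + n" by (auto simp: antipode_def split: if_splits)
    \<comment> \<open>Arbitrary \<open>i\<close> and \<open>j\<close> are clamped to the range where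
      \<open>nests_ge\<close> applies; a nested antipodal chord opens at some \<open>u\<close> in
      \<open>{i'..j' - n}\<close>.\<close>
    define i' j' where "i' = max 1 i" and "j' = min j (2*n)"
    have clamp: "nests n g i j = nests n g i' j'" if "fpf_involution n g" for g
      by (rule chords_cong) (use fpf_involutionD(1)[OF that] in \<open>auto simp: i'_def j'_def\<close>)
    have i': "1 \<le> i'" "i' \<le> 2*n" "j' \<le> 2*n" "i' + n \<le> j'"
      using u un by (auto simp: i'_def j'_def)
    have "?N = nests n (antipode n) i' j'" using clamp[OF fpf_involution_antipode] .
    also have "\<dots> \<le> (\<Sum>u\<in>{1..2*n}. of_bool (u \<in> {i'..j' - n}))"
      unfolding chords_def by (rule sum_mono) (auto simp: antipode_def of_bool_def split: if_splits)
    also have "\<dots> = (\<Sum>u\<in>{i'..j' - n}. 1)"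
      by (rule sum.mono_neutral_cong_right) (use i' in auto)
    also have "\<dots> = int j' + 1 - int i' - int n" using i' by simp
    also have "\<dots> \<le> nests n f i' j'" using nests_ge[OF f i'(1,2,3)] .
    finally show ?thesis using clamp[OF f] by simp
  qed (use nonneg in simp)
qed

section \<open>The dual poset and its edge labels\<close>

lemma covers_converse: "covers (r\<inverse>) x y \<longleftrightarrow> covers r y x"
  by (auto simp: covers_def)

lemma finite_bounded_poset_dual_uncrossing:
  "finite_bounded_poset (uncrossing_poset n) ((uncrossing_order n)\<inverse>)"
  unfolding finite_bounded_poset_def
proof (intro conjI)
  show "partial_order_on (uncrossing_poset n) ((uncrossing_order n)\<inverse>)"
    using partial_order_uncrossing by simp
  let ?T = "matching_of n (antipode n)"
  have T: "?T \<in> matchings n" "mate n ?T = antipode n"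
    by (rule matching_of_matchings[OF fpf_involution_antipode])
      (rule mate_matching_of[OF fpf_involution_antipode], auto simp: antipode_def)
  have "is_bottom (uncrossing_poset n) ((uncrossing_order n)\<inverse>) (Some ?T)"
    using T nest_le_antipode[OF fpf_involution_mate]
    by (auto simp: is_bottom_def uncrossing_poset_def order_Some_iff order_None_left)
  then show "\<exists>b. is_bottom (uncrossing_poset n) ((uncrossing_order n)\<inverse>) b" ..
  have "is_top (uncrossing_poset n) ((uncrossing_order n)\<inverse>) None"
    by (auto simp: is_top_def order_None_left uncrossing_poset_def)
  then show "\<exists>t. is_top (uncrossing_poset n) ((uncrossing_order n)\<inverse>) t" ..
qed (rule finite_uncrossing_poset)

text \<open>The description is well defined by \<open>step_label_unique\<close>. In the dual poset
  an edge ending in a matching also starts in one, so \<open>the u\<close> is meaningful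
  there.\<close>

definition edge_label :: "nat \<Rightarrow> nat set set option \<Rightarrow> nat set set option \<Rightarrow> nat" where
  "edge_label n u v = (case v of None \<Rightarrow> top_label n
     | Some N \<Rightarrow> THE l. step n (mate n (the u)) l (mate n N))"

lemma edge_label_Some:
  assumes M: "M \<in> matchings n" and s: "step n (mate n M) l (mate n N)"
  shows "edge_label n (Some M) (Some N) = l"
  unfolding edge_label_def option.case option.sel
  by (rule the_equality) (rule s, rule step_label_unique[OF fpf_involution_mate[OF M] _ s])

theorem theorem7p1:
  fixes n :: nat
  assumes "n \<ge> 1"
  shows "dual_CL_shellable (uncrossing_poset n) (uncrossing_order n)"
  unfolding dual_CL_shellable_def
proof (rule CL_shellable_if_edge_labeling[OF finite_bounded_poset_dual_uncrossing, of n "edge_label n"])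
  fix x y assume "(x, y) \<in> (uncrossing_order n)\<inverse>" and "x \<noteq> y"
  then have yx: "(y, x) \<in> uncrossing_order n" by simp
  then have yP: "y \<in> uncrossing_poset n" by (simp add: uncrossing_order_def)
  have "x \<noteq> None" using yx \<open>x \<noteq> y\<close> order_None_right by metis
  moreover have "x \<in> uncrossing_poset n" using yx by (simp add: uncrossing_order_def)
  ultimately obtain M where M: "x = Some M" "M \<in> matchings n"
    unfolding uncrossing_poset_def by blast
  note f = fpf_involution_mate[OF M(2)]
  \<comment> \<open>The adjoined element becomes the empty target, so that \<open>below\<close>
    expresses membership in the interval.\<close>
  let ?t = "map_option (mate n) y"
  have cov: "covers ((uncrossing_order n)\<inverse>) u v \<longleftrightarrow> (v, u) \<in> uncrossing_covers n" for u v
    by (simp add: covers_converse covers_uncrossing_order)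
  have None_source: "(u, None) \<notin> uncrossing_covers n" for u by (auto simp: uncrossing_covers_def)
  have covM: "w \<in> matchings n" if "(Some w, u) \<in> uncrossing_covers n" for w u
    using that by (auto simp: uncrossing_covers_def)
  show "\<exists>z. covers ((uncrossing_order n)\<inverse>) x z \<and> (z, y) \<in> (uncrossing_order n)\<inverse> \<and>
    (\<forall>w. covers ((uncrossing_order n)\<inverse>) x w \<and> (w, y) \<in> (uncrossing_order n)\<inverse> \<and> w \<noteq> z \<longrightarrow>
      edge_label n x z < edge_label n x w \<and>
      (\<exists>v. covers ((uncrossing_order n)\<inverse>) w v \<and> (v, y) \<in> (uncrossing_order n)\<inverse> \<and>
        edge_label n w v \<le> edge_label n x w)) \<and>
    (\<forall>v. covers ((uncrossing_order n)\<inverse>) z v \<and> (v, y) \<in> (uncrossing_order n)\<inverse> \<longrightarrow>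
      edge_label n x z < edge_label n z v)"
    unfolding cov converse_iff
  \<comment> \<open>If \<open>x\<close> has no crossings and \<open>y\<close> is the adjoined
    element, the only edge leads to \<open>None\<close> and nothing follows it. Otherwise
    \<open>step_exists_first\<close> applies.\<close>
  proof (cases "y = None \<and> (\<forall>u v. \<not> crossing n (mate n M) u v)")
    case True
    have "(None, x) \<in> uncrossing_covers n" using covers_None_iff[OF M(2)] True M(1) by simp
    moreover have "w = None" if w: "(w, x) \<in> uncrossing_covers n" for w
    proof (rule ccontr)
      assume "w \<noteq> None"
      then obtain N where N: "w = Some N" by blast
      then have N': "N \<in> matchings n" using covM w by blast
      obtain l where "step n (mate n M) l (mate n N)"
        using covers_iff_step[OF M(2) N'] w N M(1) by blast
      then show False using step_crossing True by blast
    qed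
    ultimately show "\<exists>z. (z, x) \<in> uncrossing_covers n \<and> (y, z) \<in> uncrossing_order n \<and>
      (\<forall>w. (w, x) \<in> uncrossing_covers n \<and> (y, w) \<in> uncrossing_order n \<and> w \<noteq> z \<longrightarrow>
        edge_label n x z < edge_label n x w \<and>
        (\<exists>v. (v, w) \<in> uncrossing_covers n \<and> (y, v) \<in> uncrossing_order n \<and> edge_label n w v \<le> edge_label n x w)) \<and>
      (\<forall>v. (v, z) \<in> uncrossing_covers n \<and> (y, v) \<in> uncrossing_order n \<longrightarrow> edge_label n x z < edge_label n z v)"
      using True None_source by (intro exI[of _ None]) (auto simp: order_None_right)
  next
    case False
    have bel: "below n (mate n M) ?t" using below_mate_iff[OF M(2) yP] yx M(1) by simp
    have ne: "case ?t of None \<Rightarrow> \<exists>u v. crossing n (mate n M) u v | Some g \<Rightarrow> \<exists>k\<in>{1..2*n}. mate n M k \<noteq> g k"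
    proof (cases y)
      case None
      then show ?thesis using False by simp
    next
      case (Some N)
      then have "N \<in> matchings n" "N \<noteq> M" using yP M(1) \<open>x \<noteq> y\<close> by (auto simp: uncrossing_poset_def)
      then have "\<not> (\<forall>k\<in>{1..2*n}. mate n M k = mate n N k)"
        using mate_inj[OF M(2), of N] mate_cong[of n M N] by metis
      then show ?thesis using Some by simp
    qed
    obtain z l where z: "step n (mate n M) l z" "below n z ?t" "?t = None \<longrightarrow> l < top_label n"
      and other: "\<And>w m. step n (mate n M) m w \<Longrightarrow> below n w ?t \<Longrightarrow> w \<noteq> z \<Longrightarrow> l < m \<and>
        (?t = None \<and> (\<forall>u v. \<not> crossing n w u v) \<and> top_label n \<le> m \<or>
         (\<exists>v k. step n w k v \<and> below n v ?t \<and> k \<le> m))"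
      and asc: "\<And>v k. step n z k v \<Longrightarrow> below n v ?t \<Longrightarrow> l < k"
      using step_exists_first[OF f bel ne] by blast
    define Z where "Z = matching_of n z"
    have Z: "Z \<in> matchings n" "mate n Z = z" using step_mate[OF M(2) z(1)] by (simp_all add: Z_def)
    have lZ: "edge_label n x (Some Z) = l" unfolding M(1) by (rule edge_label_Some) (use M Z z in auto)
    have c1: "(Some Z, x) \<in> uncrossing_covers n" using covers_iff_step[OF M(2) Z(1)] z(1) Z(2) M(1) by blast
    have c2: "(y, Some Z) \<in> uncrossing_order n" using below_mate_iff[OF Z(1) yP] z(2) Z(2) by simp
    have "edge_label n x (Some Z) < edge_label n x w \<and>
        (\<exists>v. (v, w) \<in> uncrossing_covers n \<and> (y, v) \<in> uncrossing_order n \<and> edge_label n w v \<le> edge_label n x w)"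
      if w: "(w, x) \<in> uncrossing_covers n" "(y, w) \<in> uncrossing_order n" "w \<noteq> Some Z" for w
    proof (cases w)
      case None
      then have "\<forall>u v. \<not> crossing n (mate n M) u v" using w(1) covers_None_iff[OF M(2)] M(1) by simp
      then show ?thesis using step_crossing[OF z(1)] by blast
    next
      case (Some W)
      have W: "W \<in> matchings n" using covM w(1) Some by blast
      obtain m where m: "step n (mate n M) m (mate n W)"
        using covers_iff_step[OF M(2) W] w(1) Some M(1) by blast
      have lW: "edge_label n x w = m" unfolding M(1) Some by (rule edge_label_Some[OF M(2) m])
      have "below n (mate n W) ?t" using below_mate_iff[OF W yP] w(2) Some by simp
      moreover have "mate n W \<noteq> z" using mate_inj[OF W Z(1)] Z(2) w(3) Some by auto
      ultimately have o: "l < m" "?t = None \<and> (\<forall>u v. \<not> crossing n (mate n W) u v) \<and> top_label n \<le> m \<or>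
         (\<exists>v k. step n (mate n W) k v \<and> below n v ?t \<and> k \<le> m)"
        using other[OF m] by blast+
      from o(2) have "\<exists>v. (v, w) \<in> uncrossing_covers n \<and> (y, v) \<in> uncrossing_order n \<and> edge_label n w v \<le> m"
      proof
        assume "?t = None \<and> (\<forall>u v. \<not> crossing n (mate n W) u v) \<and> top_label n \<le> m"
        \<comment> \<open>\<open>w\<close> has no crossings left, so the follow-up edge goes to the
          adjoined element.\<close>
        then show ?thesis using covers_None_iff[OF W] Some
          by (intro exI[of _ None]) (auto simp: order_None_right edge_label_def)
      next
        assume "\<exists>v k. step n (mate n W) k v \<and> below n v ?t \<and> k \<le> m"
        then obtain v k where v: "step n (mate n W) k v" "below n v ?t" "k \<le> m" by blast
        have V: "matching_of n v \<in> matchings n" "mate n (matching_of n v) = v" using step_mate[OF W v(1)] .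
        have "(Some (matching_of n v), w) \<in> uncrossing_covers n"
          using covers_iff_step[OF W V(1)] v(1) V(2) Some by auto
        moreover have "(y, Some (matching_of n v)) \<in> uncrossing_order n"
          using below_mate_iff[OF V(1) yP] v(2) V(2) by simp
        moreover have "edge_label n w (Some (matching_of n v)) = k"
          unfolding Some by (rule edge_label_Some[OF W]) (use v V in simp)
        ultimately show ?thesis using v(3) by blast
      qed
      then show ?thesis using o(1) lZ lW by simp
    qed
    moreover have "edge_label n x (Some Z) < edge_label n (Some Z) v"
      if v: "(v, Some Z) \<in> uncrossing_covers n" "(y, v) \<in> uncrossing_order n" for v
    proof (cases v)
      case None
      \<comment> \<open>This edge occurs only for the empty target, where the first label is known
        to lie below \<open>top_label n\<close>.\<close>
      then have "y = None" using v(2) by (simp add: order_None_right)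
      then show ?thesis using z(3) lZ None by (simp add: edge_label_def)
    next
      case (Some V)
      have V: "V \<in> matchings n" using covM v(1) Some by blast
      obtain k where k: "step n (mate n Z) k (mate n V)"
        using covers_iff_step[OF Z(1) V] v(1) Some by blast
      have "below n (mate n V) ?t" using below_mate_iff[OF V yP] v(2) Some by simp
      then have "l < k" using asc k Z(2) by simp
      moreover have "edge_label n (Some Z) v = k" unfolding Some by (rule edge_label_Some[OF Z(1) k])
      ultimately show ?thesis using lZ by simp
    qed
    ultimately show "\<exists>z. (z, x) \<in> uncrossing_covers n \<and> (y, z) \<in> uncrossing_order n \<and>
      (\<forall>w. (w, x) \<in> uncrossing_covers n \<and> (y, w) \<in> uncrossing_order n \<and> w \<noteq> z \<longrightarrow>
        edge_label n x z < edge_label n x w \<and>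
        (\<exists>v. (v, w) \<in> uncrossing_covers n \<and> (y, v) \<in> uncrossing_order n \<and> edge_label n w v \<le> edge_label n x w)) \<and>
      (\<forall>v. (v, z) \<in> uncrossing_covers n \<and> (y, v) \<in> uncrossing_order n \<longrightarrow> edge_label n x z < edge_label n z v)"
      using c1 c2 by blast
  qed
qed

end
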